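(* Let $\alpha>0$ and let $D\ge2$ be an integer. Let $(G,\rho)$ be a unimodular random rooted graph and $\xi$ a percolation of $(G,\rho)$ such that every vertex of $G_{D,\alpha}:=G[\xi]$ has degree at most $D$ and every infinite connected component of $G_{D,\alpha}$ has inner vertex-expansion constant at least $\alpha$. Then for every $\varepsilon\in(0,1/2)$ there is a positive integer $h$ (depending on $\varepsilon,\alpha,D$ but not on $N$) such that for every positive integer $N$ there exists a site percolation $\omega$ of $(G,\rho,\xi)$ of rate at most $\varepsilon$ such that almost surely: (I) every vertex of $G_{D,\alpha}[\omega]$ that lies in an infinite connected component of $G_{D,\alpha}$ is at distance at most $h$ in $G_{D,\alpha}$ from some vertex of $G_{D,\alpha}$ which is closed with respect to $\omega$; (II) for every vertex $v$ of $G_{D,\alpha}$ with $\omega(v)=0$, there is a set $\Psi\ni v$ of at least $N$ vertices of $G_{D,\alpha}$, all closed with respect to $\omega$, such that $G_{D,\alpha}[\Psi]$ is connected.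
   Context: A random rooted graph $(G,\rho)$ (root in a connected locally finite graph) is unimodular if for every Borel $f\ge0$ on doubly rooted (possibly marked) graphs, $\mathbb E[\sum_o f(G,\rho,o)]=\mathbb E[\sum_o f(G,o,\rho)]$. A marking is a random function from $V(G)\cup E(G)$ to a Polish space such that the marked rooted graph is unimodular; "a site percolation of $(G,\rho,\xi)$" means $(G,\rho,\xi,\omega)$ is unimodular. A percolation is a $\{0,1\}$-marking in which an edge is open (value 1) only if both endpoints are open; a site percolation additionally has every edge with both endpoints open being open. A vertex is closed if its value is 0. $G[\omega]$ denotes the subgraph of open vertices and edges, and $G_{D,\alpha}[\omega]$ the subgraph of $G_{D,\alpha}$ induced by vertices open for $\omega$. The rate of $\omega$ is $\mathbb P[\omega(\rho)=0]$. For finite $K\subseteq V$, $\partial_{\mathrm{in}}K$ is the set of vertices of $K$ adjacent to a vertex outside $K$; the inner vertex-expansion constant of a graph is $\inf\{|\partial_{\mathrm{in}}K|/|K|\}$ over finite nonempty vertex sets $K$. *)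

theory Defs
  imports "HOL-Probability.Probability"
begin

section \<open>Marked graphs on the vertex labels nat\<close>

text \<open>A (labelled) marked graph: vertex set (as predicate), adjacency relation,
 vertex marks and edge marks.  Random rooted graphs are laws on
 marked graph times root; unimodularity is tested against isomorphism-invariant
 measurable functions, so labels play no role.\<close>

type_synonym ('m,'e) mgraph =
  "(nat \<Rightarrow> bool) \<times> (nat \<Rightarrow> nat \<Rightarrow> bool) \<times> (nat \<Rightarrow> 'm) \<times> (nat \<Rightarrow> nat \<Rightarrow> 'e)"

definition gV :: "('m,'e) mgraph \<Rightarrow> nat \<Rightarrow> bool" where "gV g = fst g"
definition gE :: "('m,'e) mgraph \<Rightarrow> nat \<Rightarrow> nat \<Rightarrow> bool" where "gE g = fst (snd g)"
definition gvm :: "('m,'e) mgraph \<Rightarrow> nat \<Rightarrow> 'm" where "gvm g = fst (snd (snd g))"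
definition gem :: "('m,'e) mgraph \<Rightarrow> nat \<Rightarrow> nat \<Rightarrow> 'e" where "gem g = snd (snd (snd g))"

definition MG :: "('m,'e) mgraph measure" where
  "MG = (\<Pi>\<^sub>M x\<in>UNIV. count_space UNIV) \<Otimes>\<^sub>M
        ((\<Pi>\<^sub>M x\<in>UNIV. \<Pi>\<^sub>M y\<in>UNIV. count_space UNIV) \<Otimes>\<^sub>M
         ((\<Pi>\<^sub>M x\<in>UNIV. count_space UNIV) \<Otimes>\<^sub>M
          (\<Pi>\<^sub>M x\<in>UNIV. \<Pi>\<^sub>M y\<in>UNIV. count_space UNIV)))"

text \<open>Connected, locally finite simple graph with symmetric edge marks.\<close>
definition wf_graph :: "('m,'e) mgraph \<Rightarrow> bool" where
  "wf_graph g \<longleftrightarrow>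
     (\<forall>x y. gE g x y \<longrightarrow> gE g y x \<and> x \<noteq> y \<and> gV g x \<and> gV g y \<and> gem g x y = gem g y x) \<and>
     (\<forall>x. finite {y. gE g x y}) \<and>
     (\<forall>x y. gV g x \<and> gV g y \<longrightarrow> (x, y) \<in> {(a, b). gE g a b}\<^sup>*)"

definition relabel :: "(nat \<Rightarrow> nat) \<Rightarrow> ('m,'e) mgraph \<Rightarrow> ('m,'e) mgraph" where
  "relabel p g = (let q = inv p in
     (\<lambda>x. gV g (q x), \<lambda>x y. gE g (q x) (q y), \<lambda>x. gvm g (q x), \<lambda>x y. gem g (q x) (q y)))"

definition iso_invariant :: "(('m,'e) mgraph \<times> nat \<times> nat \<Rightarrow> ennreal) \<Rightarrow> bool" where
  "iso_invariant f \<longleftrightarrow>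
     (\<forall>p g x y. bij p \<longrightarrow> f (relabel p g, p x, p y) = f (g, x, y))"

text \<open>Mass transport principle.\<close>
definition unimodular :: "(('m,'e) mgraph \<times> nat) measure \<Rightarrow> bool" where
  "unimodular P \<longleftrightarrow>
    (\<forall>f \<in> borel_measurable (MG \<Otimes>\<^sub>M (count_space UNIV \<Otimes>\<^sub>M count_space UNIV)).
       iso_invariant f \<longrightarrow>
       (\<integral>\<^sup>+ z. (\<Sum>w. if gV (fst z) w then f (fst z, snd z, w) else 0) \<partial>P) =
       (\<integral>\<^sup>+ z. (\<Sum>w. if gV (fst z) w then f (fst z, w, snd z) else 0) \<partial>P))"

text \<open>Law of a unimodular random rooted marked graph.\<close>
definition unimodular_rrg :: "(('m,'e) mgraph \<times> nat) measure \<Rightarrow> bool" where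
  "unimodular_rrg P \<longleftrightarrow> prob_space P \<and> sets P = sets (MG \<Otimes>\<^sub>M count_space UNIV) \<and>
     (AE z in P. wf_graph (fst z) \<and> gV (fst z) (snd z)) \<and> unimodular P"

section \<open>Percolation subgraph G[xi] = G_{D,alpha}\<close>

definition pV :: "(bool,bool) mgraph \<Rightarrow> nat set" where
  "pV g = {x. gV g x \<and> gvm g x}"
definition pE :: "(bool,bool) mgraph \<Rightarrow> (nat \<times> nat) set" where
  "pE g = {(x, y). gE g x y \<and> gem g x y \<and> x \<in> pV g \<and> y \<in> pV g}"

text \<open>xi is a percolation: open edges have open endpoints.\<close>
definition is_percolation :: "(bool,bool) mgraph \<Rightarrow> bool" where
  "is_percolation g \<longleftrightarrow> (\<forall>x y. gE g x y \<and> gem g x y \<longrightarrow> gvm g x \<and> gvm g y)"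

definition pcomp :: "(bool,bool) mgraph \<Rightarrow> nat \<Rightarrow> nat set" where
  "pcomp g v = {u. (v, u) \<in> (pE g)\<^sup>*}"

definition inner_boundary :: "(nat \<times> nat) set \<Rightarrow> nat set \<Rightarrow> nat set" where
  "inner_boundary E K = {x \<in> K. \<exists>y. (x, y) \<in> E \<and> y \<notin> K}"

text \<open>Every infinite component C has inner vertex-expansion constant
  inf {|d_in K|/|K|} \<ge> alpha, i.e. every finite nonempty K \<subseteq> C has ratio \<ge> alpha.\<close>
definition expansion_ok :: "real \<Rightarrow> (bool,bool) mgraph \<Rightarrow> bool" where
  "expansion_ok \<alpha> g \<longleftrightarrow>
    (\<forall>v \<in> pV g. infinite (pcomp g v) \<longrightarrow>
       (\<forall>K. finite K \<and> K \<noteq> {} \<and> K \<subseteq> pcomp g v \<longrightarrow>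
            \<alpha> * real (card K) \<le> real (card (inner_boundary (pE g) K))))"

definition degree_ok :: "nat \<Rightarrow> (bool,bool) mgraph \<Rightarrow> bool" where
  "degree_ok D g \<longleftrightarrow> (\<forall>x \<in> pV g. card {y. (x, y) \<in> pE g} \<le> D)"

section \<open>Site percolation omega of (G,rho,xi)\<close>

text \<open>The vertex marks become (xi v, omega v); edge marks stay xi.
  Edges of omega are determined (open iff both endpoints open).\<close>
definition forget :: "(bool \<times> bool, bool) mgraph \<Rightarrow> (bool,bool) mgraph" where
  "forget g = (gV g, gE g, \<lambda>x. fst (gvm g x), gem g)"

definition forget_root :: "(bool \<times> bool, bool) mgraph \<times> nat \<Rightarrow> (bool,bool) mgraph \<times> nat" where
  "forget_root z = (forget (fst z), snd z)"

definition om :: "(bool \<times> bool, bool) mgraph \<Rightarrow> nat \<Rightarrow> bool" where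
  "om g x = snd (gvm g x)"

text \<open>Property (I).\<close>
definition propI :: "nat \<Rightarrow> (bool \<times> bool, bool) mgraph \<Rightarrow> bool" where
  "propI h g \<longleftrightarrow>
    (\<forall>v. v \<in> pV (forget g) \<and> om g v \<and> infinite (pcomp (forget g) v) \<longrightarrow>
       (\<exists>u k. u \<in> pV (forget g) \<and> \<not> om g u \<and> k \<le> h \<and> (v, u) \<in> (pE (forget g)) ^^ k))"

text \<open>Property (II).\<close>
definition propII :: "nat \<Rightarrow> (bool \<times> bool, bool) mgraph \<Rightarrow> bool" where
  "propII N g \<longleftrightarrow>
    (\<forall>v. v \<in> pV (forget g) \<and> \<not> om g v \<longrightarrow>
       (\<exists>\<Psi>. v \<in> \<Psi> \<and> (infinite \<Psi> \<or> N \<le> card \<Psi>) \<and>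
            (\<forall>u \<in> \<Psi>. u \<in> pV (forget g) \<and> \<not> om g u) \<and>
            (\<forall>x \<in> \<Psi>. \<forall>y \<in> \<Psi>. (x, y) \<in> (pE (forget g) \<inter> (\<Psi> \<times> \<Psi>))\<^sup>*)))"

end

theory Submission
  imports Defs "HOL-Real_Asymp.Real_Asymp"
begin

text \<open>Give all finite lists of vertices independent uniform labels.  In every infinite component of
  \<open>G[\<xi>]\<close> expansion forces \<open>r\<close>-balls to have at least \<open>(1 + \<alpha>)\<^sup>r\<close> vertices, so the vertices with label below
  \<open>q = (1 + \<alpha>) powr (-r/2)\<close>, together with the centres of the \<open>r\<close>-balls containing no such vertex, form
  an \<open>r\<close>-net of density at most \<open>2q\<close>.  Then proceed as in Boruvka's algorithm: as long as a cluster of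
  the net is finite, it is joined to another cluster by the path with the smallest label among those
  with at most \<open>m = 2r + 2\<close> vertices.  Each round doubles the minimal size of a cluster, and
  by the mass transport principle it halves the density of finite clusters, while the density of
  the set grows by at most \<open>m\<close> times the former.  Hence (density of the set) \<open>+ 2m\<close> (density of finite
  clusters) never increases, and all stages have density at most \<open>(4r + 5) \<cdot> 2q\<close>.  This is below
  \<open>\<epsilon>\<close> for large \<open>r\<close>, uniformly in the number of rounds, so that \<open>h = r\<close> does not depend on \<open>N\<close>.\<close>

section \<open>Clusters and bridges\<close>

text \<open>For \<open>x\<close> in \<open>S\<close> this is the component of \<open>x\<close> in
  the subgraph induced by \<open>S\<close>; for \<open>x\<close> outside \<open>S\<close> it
  degenerates to the singleton of \<open>x\<close>.\<close>

definition cluster :: "('v \<times> 'v) set \<Rightarrow> 'v set \<Rightarrow> 'v \<Rightarrow> 'v set" where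
  "cluster E S x = {y. (x, y) \<in> (E \<inter> S \<times> S)\<^sup>*}"

text \<open>The path is directed: it starts in a finite cluster, while its far end may lie in a
  cluster of any size. The bound \<open>m\<close> counts vertices, not edges, and repeated vertices
  are allowed.\<close>

definition bridge :: "('v \<times> 'v) set \<Rightarrow> nat \<Rightarrow> 'v set \<Rightarrow> 'v list \<Rightarrow> bool" where
  "bridge E m S xs \<longleftrightarrow> xs \<noteq> [] \<and> length xs \<le> m \<and> successively (\<lambda>x y. (x, y) \<in> E) xs \<and>
     hd xs \<in> S \<and> last xs \<in> S \<and> finite (cluster E S (hd xs)) \<and> last xs \<notin> cluster E S (hd xs)"

text \<open>The competitors are all bridges that start anywhere in the same cluster, so that the
  choice belongs to the cluster and not to its vertex \<open>hd xs\<close>.\<close>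

definition min_bridge ::
  "('v \<times> 'v) set \<Rightarrow> nat \<Rightarrow> ('v list \<Rightarrow> real) \<Rightarrow> 'v set \<Rightarrow> 'v list \<Rightarrow> bool" where
  "min_bridge E m U S xs \<longleftrightarrow> bridge E m S xs \<and>
     (\<forall>ys. bridge E m S ys \<and> hd ys \<in> cluster E S (hd xs) \<longrightarrow> U xs \<le> U ys)"

text \<open>One Boruvka round: all finite clusters add their chosen bridges simultaneously, and
  infinite clusters choose none.\<close>

definition grow :: "('v \<times> 'v) set \<Rightarrow> nat \<Rightarrow> ('v list \<Rightarrow> real) \<Rightarrow> 'v set \<Rightarrow> 'v set" where
  "grow E m U S = S \<union> {v. \<exists>xs. min_bridge E m U S xs \<and> v \<in> set xs}"

text \<open>Confining \<open>S\<close> to infinite components guarantees that a finite cluster never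
  exhausts its component, so that there is always somewhere to go from it.\<close>

definition net :: "('v \<times> 'v) set \<Rightarrow> nat \<Rightarrow> 'v set \<Rightarrow> bool" where
  "net E r S \<longleftrightarrow> S \<subseteq> {v. infinite (E\<^sup>* `` {v})} \<and>
     (\<forall>v. infinite (E\<^sup>* `` {v}) \<longrightarrow> (\<exists>u\<in>S. \<exists>k\<le>r. (v, u) \<in> E ^^ k))"

definition ball_rel :: "('v \<times> 'v) set \<Rightarrow> nat \<Rightarrow> 'v \<Rightarrow> 'v set" where
  "ball_rel E r v = {w. \<exists>k\<le>r. (v, w) \<in> E ^^ k}"

lemma relpow_successively:
  assumes "(x, y) \<in> E ^^ n"
  obtains xs where "xs \<noteq> []" "length xs = Suc n" "successively (\<lambda>x y. (x, y) \<in> E) xs" "hd xs = x" "last xs = y"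
proof -
  have "\<exists>xs. xs \<noteq> [] \<and> length xs = Suc n \<and> successively (\<lambda>x y. (x, y) \<in> E) xs \<and> hd xs = x \<and> last xs = y"
    using assms
  proof (induction n arbitrary: x)
    case 0
    then show ?case by (intro exI[of _ "[x]"]) auto
  next
    case (Suc n)
    from Suc.prems obtain z where z: "(x, z) \<in> E" "(z, y) \<in> E ^^ n" by (meson relpow_Suc_D2)
    from Suc.IH[OF z(2)] obtain xs where "xs \<noteq> []" "length xs = Suc n"
      "successively (\<lambda>x y. (x, y) \<in> E) xs" "hd xs = z" "last xs = y" by blast
    then show ?case using z(1) by (intro exI[of _ "x # xs"]) (auto simp: successively_Cons)
  qed
  then show ?thesis using that by blast
qed

lemma cluster_refl [simp]: "x \<in> cluster E S x"
  by (simp add: cluster_def)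

lemma cluster_mono: "S \<subseteq> T \<Longrightarrow> cluster E S x \<subseteq> cluster E T x"
  unfolding cluster_def by (auto elim!: rtrancl_mono[THEN subsetD, rotated])

lemma cluster_trans: "y \<in> cluster E S x \<Longrightarrow> z \<in> cluster E S y \<Longrightarrow> z \<in> cluster E S x"
  unfolding cluster_def by auto

lemma cluster_subset: "x \<in> S \<Longrightarrow> cluster E S x \<subseteq> S"
  unfolding cluster_def by (auto elim: rtranclE)

lemma successively_rtrancl_within:
  "successively (\<lambda>x y. (x, y) \<in> E) xs \<Longrightarrow> set xs \<subseteq> S \<Longrightarrow> v \<in> set xs \<Longrightarrow> v \<in> cluster E S (hd xs)"
proof (induction xs rule: induct_list012)
  case (3 x y zs)
  have "y \<in> cluster E S x"
    using 3 by (auto simp: cluster_def)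
  moreover have "v \<in> cluster E S y" if "v \<noteq> x"
    using 3 that by auto
  ultimately show ?case
    by (cases "v = x") (auto intro: cluster_trans)
qed (auto simp: cluster_def)

lemma min_bridge_set_subset: "min_bridge E m U S xs \<Longrightarrow> set xs \<subseteq> grow E m U S"
  unfolding grow_def by auto

lemma grow_increasing: "S \<subseteq> grow E m U S"
  unfolding grow_def by auto

lemma rtrancl_exit:
  assumes "(x, y) \<in> E\<^sup>*" "x \<in> A" "y \<notin> A"
  obtains a b where "a \<in> A" "b \<notin> A" "(a, b) \<in> E" "(x, b) \<in> E\<^sup>*"
proof -
  have "\<exists>a b. a \<in> A \<and> b \<notin> A \<and> (a, b) \<in> E \<and> (x, b) \<in> E\<^sup>*"
    using assms
  proof (induction rule: rtrancl_induct)
    case (step y z)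
    then show ?case
      by (cases "y \<in> A") (auto intro: rtrancl_into_rtrancl)
  qed auto
  then show ?thesis using that by blast
qed

section \<open>Ball growth, existence of bridges and doubling of clusters in a locally finite
  graph\<close>

locale locally_finite_graph =
  fixes E :: "('v \<times> 'v) set"
  assumes sym_edges: "sym E" and finite_nbrs: "finite (E `` {x})"
begin

lemma cluster_sym: "y \<in> cluster E S x \<Longrightarrow> x \<in> cluster E S y"
proof -
  have "sym ((E \<inter> S \<times> S)\<^sup>*)"
    using sym_edges by (intro sym_rtrancl) (auto simp: sym_def)
  then show "y \<in> cluster E S x \<Longrightarrow> x \<in> cluster E S y"
    unfolding cluster_def by (auto dest: symD)
qed

lemma cluster_eq: "y \<in> cluster E S x \<Longrightarrow> cluster E S y = cluster E S x"
  using cluster_sym cluster_trans by (metis subsetI subset_antisym)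

lemma relpow_sym: "(x, y) \<in> E ^^ k \<Longrightarrow> (y, x) \<in> E ^^ k"
proof (induction k arbitrary: y)
  case (Suc k)
  then obtain z where "(x, z) \<in> E ^^ k" "(z, y) \<in> E" by auto
  then show ?case using Suc.IH sym_edges by (metis relpow_Suc_I2 symD)
qed auto

lemma infinite_component_cong:
  assumes "(x, y) \<in> E\<^sup>*" "infinite (E\<^sup>* `` {x})"
  shows "infinite (E\<^sup>* `` {y})"
proof -
  have "(y, x) \<in> E\<^sup>*" using assms(1) sym_edges by (meson symD sym_rtrancl)
  then have "E\<^sup>* `` {x} \<subseteq> E\<^sup>* `` {y}" by auto
  then show ?thesis using assms(2) finite_subset by blast
qed

lemma finite_relpow_Image: "finite C \<Longrightarrow> finite ((E ^^ k) `` C)"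
proof (induction k)
  case (Suc k)
  have "(E ^^ Suc k) `` C = (\<Union>x\<in>(E ^^ k) `` C. E `` {x})" by auto
  then show ?case using Suc finite_nbrs by auto
qed auto

lemma finite_ball_rel: "finite (ball_rel E r x)"
proof -
  have "ball_rel E r x = (\<Union>k\<le>r. (E ^^ k) `` {x})" by (auto simp: ball_rel_def)
  then show ?thesis using finite_relpow_Image by auto
qed

lemma ball_rel_subset_component: "ball_rel E r v \<subseteq> E\<^sup>* `` {v}"
  by (auto simp: ball_rel_def relpow_imp_rtrancl)

lemma ball_rel_Suc: "w \<in> ball_rel E r v \<Longrightarrow> (w, u) \<in> E \<Longrightarrow> u \<in> ball_rel E (Suc r) v"
proof -
  assume "w \<in> ball_rel E r v" "(w, u) \<in> E"
  then obtain k where "k \<le> r" "(v, w) \<in> E ^^ k" unfolding ball_rel_def by blast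
  then have "Suc k \<le> Suc r" "(v, u) \<in> E ^^ Suc k" using \<open>(w, u) \<in> E\<close> by auto
  then show "u \<in> ball_rel E (Suc r) v" unfolding ball_rel_def by blast
qed

lemma ball_rel_mono: "r \<le> s \<Longrightarrow> ball_rel E r v \<subseteq> ball_rel E s v"
  unfolding ball_rel_def by (smt (verit, best) mem_Collect_eq order_trans subsetI)

text \<open>A neighbour of a vertex of the \<open>r\<close>-ball lies in the ball of radius
  \<open>Suc r\<close>. Hence the inner boundary of the larger ball avoids the smaller one, and
  expansion bounds the difference of the two sizes from below.\<close>

lemma card_ball_rel_ge:
  assumes exp: "\<And>K. finite K \<Longrightarrow> K \<noteq> {} \<Longrightarrow> K \<subseteq> E\<^sup>* `` {v} \<Longrightarrow>
     \<alpha> * real (card K) \<le> real (card {x \<in> K. \<exists>y. (x, y) \<in> E \<and> y \<notin> K})" and "\<alpha> > 0"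
  shows "(1 + \<alpha>) ^ r \<le> real (card (ball_rel E r v))"
proof (induction r)
  case 0
  have "ball_rel E 0 v = {v}" by (auto simp: ball_rel_def)
  then show ?case by simp
next
  case (Suc r)
  let ?A = "ball_rel E r v" and ?B = "ball_rel E (Suc r) v"
  have sub: "?A \<subseteq> ?B" by (rule ball_rel_mono) simp
  have "v \<in> ?B" unfolding ball_rel_def by (auto intro!: exI[of _ 0])
  then have ne: "?B \<noteq> {}" by auto
  have "\<alpha> * real (card ?B) \<le> real (card {x \<in> ?B. \<exists>y. (x, y) \<in> E \<and> y \<notin> ?B})"
    by (rule exp[OF finite_ball_rel ne ball_rel_subset_component])
  also have "\<dots> \<le> real (card (?B - ?A))"
    using ball_rel_Suc by (intro of_nat_mono card_mono finite_Diff finite_ball_rel) blast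
  also have "\<dots> = real (card ?B) - real (card ?A)"
    using card_Diff_subset[OF finite_ball_rel sub] card_mono[OF finite_ball_rel sub] by simp
  finally have 1: "\<alpha> * real (card ?B) \<le> real (card ?B) - real (card ?A)" .
  \<comment> \<open>Weakening the left side of fact 1 to the smaller ball yields the factor
    \<open>1 + \<alpha>\<close> directly, without a division by \<open>1 - \<alpha>\<close>.\<close>
  have "\<alpha> * real (card ?A) \<le> \<alpha> * real (card ?B)"
    using card_mono[OF finite_ball_rel sub] \<open>\<alpha> > 0\<close> by simp
  with 1 have "(1 + \<alpha>) * real (card ?A) \<le> real (card ?B)" by (simp add: algebra_simps)
  moreover have "(1 + \<alpha>) * (1 + \<alpha>) ^ r \<le> (1 + \<alpha>) * real (card ?A)"
    using Suc \<open>\<alpha> > 0\<close> by (intro mult_left_mono) auto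
  ultimately show ?case by simp
qed

text \<open>This makes the minimal label attained. A walk from \<open>C\<close> is a vertex of
  \<open>C\<close> followed by a shorter walk from the neighbourhood of \<open>C\<close>, which is
  again finite; hence the induction has \<open>C\<close> arbitrary.\<close>

lemma finite_bridges:
  assumes "finite C"
  shows "finite {xs. bridge E m S xs \<and> hd xs \<in> C}"
proof -
  have "finite {xs. xs \<noteq> [] \<and> length xs = n \<and> successively (\<lambda>x y. (x, y) \<in> E) xs \<and> hd xs \<in> C}" for n
    using assms
  proof (induction n arbitrary: C)
    case (Suc n)
    let ?X = "{xs. xs \<noteq> [] \<and> length xs = n \<and> successively (\<lambda>x y. (x, y) \<in> E) xs \<and> hd xs \<in> E `` C}"
    have "E `` C = (\<Union>x\<in>C. E `` {x})" by auto
    then have "finite (E `` C)" using Suc.prems finite_nbrs by auto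
    then have fin: "finite ?X" by (rule Suc.IH)
    have "{xs. xs \<noteq> [] \<and> length xs = Suc n \<and> successively (\<lambda>x y. (x, y) \<in> E) xs \<and> hd xs \<in> C}
       \<subseteq> (\<lambda>(x, xs). x # xs) ` (C \<times> (insert [] ?X))"
    proof
      fix xs assume *: "xs \<in> {xs. xs \<noteq> [] \<and> length xs = Suc n \<and> successively (\<lambda>x y. (x, y) \<in> E) xs \<and> hd xs \<in> C}"
      then obtain x ys where "xs = x # ys" by (cases xs) auto
      with * show "xs \<in> (\<lambda>(x, xs). x # xs) ` (C \<times> (insert [] ?X))"
        by (auto simp: successively_Cons image_iff)
    qed
    then show ?case using fin Suc.prems by (meson finite_SigmaI finite_imageI finite_insert finite_subset)
  qed auto
  then have "finite (\<Union>n\<le>m. {xs. xs \<noteq> [] \<and> length xs = n \<and> successively (\<lambda>x y. (x, y) \<in> E) xs \<and> hd xs \<in> C})"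
    by auto
  then show ?thesis by (rule finite_subset[rotated]) (auto simp: bridge_def)
qed

text \<open>The \<open>r\<close>-neighbourhood \<open>A\<close> of the cluster is finite and the
  component is not, so some edge \<open>(a, b)\<close> leaves \<open>A\<close>. The net has a point
  \<open>u\<close> within \<open>r\<close> of \<open>b\<close>, and \<open>u\<close> is outside the
  cluster because \<open>b\<close> is outside \<open>A\<close>. Going from the cluster through
  \<open>a\<close> and \<open>b\<close> to \<open>u\<close> takes at most \<open>r + 1 + r\<close>
  edges, hence \<open>2 * r + 2\<close> vertices.\<close>

lemma bridge_exists:
  assumes net: "net E r S" and "x \<in> S" and fin: "finite (cluster E S x)"
  obtains xs where "bridge E (2 * r + 2) S xs" "hd xs \<in> cluster E S x"
proof -
  let ?C = "cluster E S x"
  define A where "A = (\<Union>c\<in>?C. ball_rel E r c)"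
  have "finite A" using fin finite_ball_rel by (auto simp: A_def)
  moreover have inf: "infinite (E\<^sup>* `` {x})" using net \<open>x \<in> S\<close> by (auto simp: net_def)
  ultimately obtain y where y: "(x, y) \<in> E\<^sup>*" "y \<notin> A"
    by (metis Image_singleton_iff finite_subset subsetI)
  have "x \<in> ball_rel E r x" unfolding ball_rel_def by (auto intro!: exI[of _ 0])
  then have "x \<in> A" by (auto simp: A_def intro!: bexI[of _ x])
  from rtrancl_exit[OF y(1) this y(2)] obtain a b where
    ab: "a \<in> A" "b \<notin> A" "(a, b) \<in> E" "(x, b) \<in> E\<^sup>*" by blast
  from ab(1) obtain c i where c: "c \<in> ?C" "i \<le> r" "(c, a) \<in> E ^^ i"
    by (auto simp: A_def ball_rel_def)
  have "infinite (E\<^sup>* `` {b})" using infinite_component_cong[OF ab(4) inf] .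
  then obtain u j where u: "u \<in> S" "j \<le> r" "(b, u) \<in> E ^^ j" using net by (auto simp: net_def)
  have "u \<notin> ?C"
    using ab(2) relpow_sym[OF u(3)] u(2) by (auto simp: A_def ball_rel_def)
  have "(c, u) \<in> E ^^ (Suc i + j)"
    using c(3) ab(3) u(3) by (metis relpow_Suc_I relpow_trans)
  then obtain xs where xs: "xs \<noteq> []" "length xs = Suc (Suc i + j)"
    "successively (\<lambda>x y. (x, y) \<in> E) xs" "hd xs = c" "last xs = u"
    by (rule relpow_successively)
  have "c \<in> S" using c(1) cluster_subset[OF \<open>x \<in> S\<close>] by auto
  have "bridge E (2 * r + 2) S xs"
    unfolding bridge_def using xs c(2) u(1,2) \<open>c \<in> S\<close> fin \<open>u \<notin> ?C\<close> cluster_eq[OF c(1)] by auto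
  then show ?thesis using that c(1) xs(4) by auto
qed

lemma min_bridge_exists:
  assumes "net E r S" and "x \<in> S" and fin: "finite (cluster E S x)"
  obtains xs where "min_bridge E (2 * r + 2) U S xs" "hd xs \<in> cluster E S x"
proof -
  let ?B = "{xs. bridge E (2 * r + 2) S xs \<and> hd xs \<in> cluster E S x}"
  have "finite ?B" using finite_bridges[OF fin] .
  moreover have "?B \<noteq> {}" using bridge_exists[OF assms] by auto
  ultimately obtain xs where "xs \<in> ?B" "\<forall>ys\<in>?B. U xs \<le> U ys"
    by (metis (mono_tags, lifting) arg_min_if_finite(1) arg_min_least)
  then show ?thesis using that[of xs] cluster_eq[of "hd xs" S x] by (auto simp: min_bridge_def)
qed

text \<open>Both lists minimise \<open>U\<close> over the same set of bridges, so their labels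
  agree. This is why a finite cluster has just one representative.\<close>

lemma min_bridge_unique:
  assumes "inj U" "min_bridge E m U S xs" "min_bridge E m U S ys" "hd ys \<in> cluster E S (hd xs)"
  shows "xs = ys"
proof -
  have "U xs \<le> U ys" "U ys \<le> U xs"
    using assms cluster_sym[OF assms(4)] by (auto simp: min_bridge_def)
  then show ?thesis using assms(1) by (auto dest: injD)
qed

text \<open>The covering condition survives enlarging the set, and the vertices of a bridge lie in
  the component of its head, which is infinite.\<close>

lemma net_grow:
  assumes "net E r S"
  shows "net E r (grow E m U S)"
proof -
  have "infinite (E\<^sup>* `` {v})" if "min_bridge E m U S xs" "v \<in> set xs" for xs v
  proof -
    have "successively (\<lambda>x y. (x, y) \<in> E) xs"
      using that(1) unfolding min_bridge_def bridge_def by blast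
    from successively_rtrancl_within[OF this subset_UNIV that(2)]
    have "(hd xs, v) \<in> E\<^sup>*" unfolding cluster_def by simp
    moreover have "infinite (E\<^sup>* `` {hd xs})"
      using assms that(1) unfolding net_def min_bridge_def bridge_def by blast
    ultimately show ?thesis by (rule infinite_component_cong)
  qed
  then show ?thesis using assms unfolding net_def grow_def by blast
qed

text \<open>Old clusters that meet a finite new cluster are contained in it, hence finite, hence
  each has a minimal bridge; the far end of such a bridge lies in a second old cluster, merged into
  the same new one. The two clusters are given through their minimal bridges because the heads of
  these serve as representatives in the mass transport.\<close>

lemma grow_cluster_contains_two:
  assumes net: "net E r S" and m: "m = 2 * r + 2" and x: "x \<in> grow E m U S"
    and fin: "finite (cluster E (grow E m U S) x)"
  obtains xs ys where "min_bridge E m U S xs" "min_bridge E m U S ys"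
    "hd ys \<notin> cluster E S (hd xs)"
    "cluster E S (hd xs) \<subseteq> cluster E (grow E m U S) x"
    "cluster E S (hd ys) \<subseteq> cluster E (grow E m U S) x"
proof -
  let ?T = "grow E m U S"
  have sub: "cluster E S s \<subseteq> cluster E ?T x" if "s \<in> cluster E ?T x" for s
    using cluster_mono[OF grow_increasing, of E S s E m U] cluster_eq[OF that] by auto
  \<comment> \<open>A vertex added in this round lies on a bridge, whose head is an old vertex of
    the same new cluster.\<close>
  obtain s where s: "s \<in> S" "s \<in> cluster E ?T x"
  proof (cases "x \<in> S")
    case False
    then obtain zs where zs: "min_bridge E m U S zs" "x \<in> set zs" using x by (auto simp: grow_def)
    then have "x \<in> cluster E ?T (hd zs)" "hd zs \<in> S"
      using successively_rtrancl_within[OF _ min_bridge_set_subset[OF zs(1)]]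
      by (auto simp: min_bridge_def bridge_def)
    then show ?thesis using that cluster_sym by blast
  next
    case True
    then show ?thesis using that[of x] by simp
  qed
  have fs: "finite (cluster E S t)" if "t \<in> cluster E ?T x" for t
    using sub[OF that] fin finite_subset by blast
  obtain xs where xs: "min_bridge E m U S xs" "hd xs \<in> cluster E S s"
    using min_bridge_exists[OF net s(1) fs[OF s(2)]] m by auto
  have hx: "hd xs \<in> cluster E ?T x" using xs(2) sub[OF s(2)] by auto
  have l: "last xs \<in> S" "last xs \<notin> cluster E S (hd xs)" and ne: "xs \<noteq> []"
    and suc: "successively (\<lambda>x y. (x, y) \<in> E) xs"
    using xs(1) by (auto simp: min_bridge_def bridge_def)
  have "last xs \<in> cluster E ?T (hd xs)"
    using successively_rtrancl_within[OF suc min_bridge_set_subset[OF xs(1)]] ne by auto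
  then have lx: "last xs \<in> cluster E ?T x" using hx cluster_trans by metis
  \<comment> \<open>The cluster at the far end of \<open>xs\<close> is finite as well and so has a
    minimal bridge of its own.\<close>
  obtain ys where ys: "min_bridge E m U S ys" "hd ys \<in> cluster E S (last xs)"
    using min_bridge_exists[OF net l(1) fs[OF lx]] m by auto
  have hy: "hd ys \<in> cluster E ?T x" using ys(2) sub[OF lx] by auto
  have "hd ys \<notin> cluster E S (hd xs)"
    using ys(2) l(2) cluster_sym cluster_trans by metis
  then show ?thesis using that[OF xs(1) ys(1)] sub hx hy by blast
qed

lemma net_grow_iterate: "net E r S \<Longrightarrow> net E r ((grow E m U ^^ n) S)"
  by (induction n) (simp_all add: net_grow)

text \<open>A finite cluster contains two disjoint finite clusters of the preceding stage, so the
  lower bound doubles. Finiteness must be assumed since \<open>card\<close> is 0 on infinite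
  sets.\<close>

lemma card_cluster_grow_iterate:
  assumes "net E r S" and m: "m = 2 * r + 2"
  shows "x \<in> (grow E m U ^^ n) S \<Longrightarrow> finite (cluster E ((grow E m U ^^ n) S) x) \<Longrightarrow>
    2 ^ n \<le> card (cluster E ((grow E m U ^^ n) S) x)"
proof (induction n arbitrary: x)
  case 0
  then show ?case
    by (simp add: Suc_le_eq card_gt_0_iff) (metis cluster_refl empty_iff)
next
  case (Suc n)
  let ?S = "(grow E m U ^^ n) S"
  have net: "net E r ?S" by (rule net_grow_iterate[OF assms(1)])
  have T: "(grow E m U ^^ Suc n) S = grow E m U ?S" by simp
  obtain xs ys where
    *: "min_bridge E m U ?S xs" "min_bridge E m U ?S ys" "hd ys \<notin> cluster E ?S (hd xs)"
    "cluster E ?S (hd xs) \<subseteq> cluster E (grow E m U ?S) x"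
    "cluster E ?S (hd ys) \<subseteq> cluster E (grow E m U ?S) x"
    by (rule grow_cluster_contains_two[OF net m Suc.prems[unfolded T]])
  have fin: "finite (cluster E ?S (hd xs))" "finite (cluster E ?S (hd ys))"
    and h: "hd xs \<in> ?S" "hd ys \<in> ?S"
    using *(1,2) by (auto simp: min_bridge_def bridge_def)
  have disj: "cluster E ?S (hd xs) \<inter> cluster E ?S (hd ys) = {}"
    using *(3) cluster_sym cluster_trans by (metis disjoint_iff)
  have "2 ^ Suc n \<le> card (cluster E ?S (hd xs)) + card (cluster E ?S (hd ys))"
    using Suc.IH[OF h(1) fin(1)] Suc.IH[OF h(2) fin(2)] by simp
  also have "\<dots> = card (cluster E ?S (hd xs) \<union> cluster E ?S (hd ys))"
    using fin disj by (simp add: card_Un_disjoint)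
  also have "\<dots> \<le> card (cluster E (grow E m U ?S) x)"
    using * Suc.prems by (intro card_mono) auto
  finally show ?case by simp
qed

end

text \<open>The label of a vertex \<open>v\<close> is \<open>U [v]\<close>. The second alternative
  repairs the places that the low labels fail to cover, which makes the net property hold surely and
  not only with high probability.\<close>

definition seeds :: "('v \<times> 'v) set \<Rightarrow> nat \<Rightarrow> real \<Rightarrow> ('v list \<Rightarrow> real) \<Rightarrow> 'v set" where
  "seeds E r q U = {v. infinite (E\<^sup>* `` {v}) \<and>
     (U [v] < q \<or> (\<forall>w\<in>ball_rel E r v. q \<le> U [w]))}"

text \<open>The length \<open>2 * r + 2\<close> is the one for which \<open>bridge_exists\<close>
  supplies bridges between clusters of an \<open>r\<close>-net.\<close>

definition closed_set ::
  "('v \<times> 'v) set \<Rightarrow> nat \<Rightarrow> real \<Rightarrow> nat \<Rightarrow> ('v list \<Rightarrow> real) \<Rightarrow> 'v set" where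
  "closed_set E r q n U = (grow E (2 * r + 2) U ^^ n) (seeds E r q U)"

text \<open>A finite cluster is represented by the head of its unique minimal bridge.\<close>

definition head_of_bridge ::
  "('v \<times> 'v) set \<Rightarrow> nat \<Rightarrow> ('v list \<Rightarrow> real) \<Rightarrow> 'v set \<Rightarrow> 'v \<Rightarrow> bool" where
  "head_of_bridge E m U S x \<longleftrightarrow> (\<exists>xs. min_bridge E m U S xs \<and> hd xs = x)"

lemma (in locally_finite_graph) net_seeds: "net E r (seeds E r q U)"
  unfolding net_def
proof (intro conjI allI impI)
  fix v assume inf: "infinite (E\<^sup>* `` {v})"
  show "\<exists>u\<in>seeds E r q U. \<exists>k\<le>r. (v, u) \<in> E ^^ k"
  proof (cases "\<exists>w\<in>ball_rel E r v. U [w] < q")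
    case True
    then obtain w where w: "w \<in> ball_rel E r v" "U [w] < q" by blast
    then have "infinite (E\<^sup>* `` {w})"
      using infinite_component_cong[OF _ inf] ball_rel_subset_component by blast
    then have "w \<in> seeds E r q U" using w(2) by (simp add: seeds_def)
    then show ?thesis using w(1) unfolding ball_rel_def by blast
  next
    case False
    then have "v \<in> seeds E r q U" using inf by (simp add: seeds_def not_less)
    moreover have "(v, v) \<in> E ^^ 0" by simp
    ultimately show ?thesis by blast
  qed
qed (auto simp: seeds_def)

section \<open>Equivariance under relabelling\<close>

lemma rtrancl_bij_imp:
  assumes "(x, y) \<in> E\<^sup>*" "\<And>x y. (x, y) \<in> E \<Longrightarrow> (p x, p y) \<in> E'"
  shows "(p x, p y) \<in> E'\<^sup>*"
  using assms(1) by (induction rule: rtrancl_induct) (auto intro: rtrancl_into_rtrancl assms(2))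

lemma rtrancl_bij_iff:
  assumes "bij p" "\<And>x y. (p x, p y) \<in> E' \<longleftrightarrow> (x, y) \<in> E"
  shows "(p x, p y) \<in> E'\<^sup>* \<longleftrightarrow> (x, y) \<in> E\<^sup>*"
proof
  assume "(p x, p y) \<in> E'\<^sup>*"
  then have "(inv p (p x), inv p (p y)) \<in> E\<^sup>*"
    by (rule rtrancl_bij_imp) (metis assms bij_inv_eq_iff)
  then show "(x, y) \<in> E\<^sup>*" using assms(1) by (simp add: bij_is_inj)
qed (use rtrancl_bij_imp[of x y E p E'] assms(2) in blast)

lemma relpow_bij_iff:
  assumes "bij p" "\<And>x y. (p x, p y) \<in> E' \<longleftrightarrow> (x, y) \<in> E"
  shows "(p x, p y) \<in> E' ^^ k \<longleftrightarrow> (x, y) \<in> E ^^ k"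
proof (induction k arbitrary: y)
  case 0
  then show ?case using assms(1) by (auto simp: bij_is_inj inj_eq)
next
  case (Suc k)
  have "(p x, p y) \<in> E' ^^ Suc k \<longleftrightarrow> (\<exists>z. (p x, z) \<in> E' ^^ k \<and> (z, p y) \<in> E')"
    by auto
  also have "\<dots> \<longleftrightarrow> (\<exists>z. (p x, p z) \<in> E' ^^ k \<and> (p z, p y) \<in> E')"
    using assms(1) by (metis bij_pointE)
  also have "\<dots> \<longleftrightarrow> (x, y) \<in> E ^^ Suc k" using Suc.IH assms(2) by auto
  finally show ?case .
qed

lemma min_bridge_not_Nil: "min_bridge E m U S xs \<Longrightarrow> xs \<noteq> []"
  by (simp add: min_bridge_def bridge_def)

text \<open>An isomorphism of graphs. Labels are pulled back along it: each statement below has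
  \<open>U\<close> on the target and \<open>U \<circ> map p\<close> on the source, which is the
  transformation that preserves the law of the labels.\<close>

locale relabelling =
  fixes p :: "'v \<Rightarrow> 'w" and E :: "('v \<times> 'v) set" and E' :: "('w \<times> 'w) set"
  assumes bij: "bij p" and edges: "\<And>x y. (p x, p y) \<in> E' \<longleftrightarrow> (x, y) \<in> E"
begin

lemma obtain_preimage: obtains x where "y = p x"
  using bij by (metis bij_pointE)

lemma eq_image: "(\<And>x. p x \<in> A' \<longleftrightarrow> x \<in> A) \<Longrightarrow> A' = p ` A"
  by (auto simp: image_iff) (metis obtain_preimage)

lemma finite_iff: "(\<And>x. p x \<in> A' \<longleftrightarrow> x \<in> A) \<Longrightarrow> finite A' \<longleftrightarrow> finite A"
  using eq_image[of A' A] bij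
  by (metis bij_betw_def finite_image_iff inj_on_subset subset_UNIV)

lemma ex_map_iff: "(\<exists>ys. P ys) \<longleftrightarrow> (\<exists>xs. P (map p xs))"
proof -
  have "ys = map p (map (inv p) ys)" for ys
    using bij by (simp add: bij_is_surj surj_f_inv_f comp_def)
  then show ?thesis by metis
qed

lemma all_map_iff: "(\<forall>ys. P ys) \<longleftrightarrow> (\<forall>xs. P (map p xs))"
  using ex_map_iff[of "\<lambda>ys. \<not> P ys"] by blast

lemma ball_rel_iff: "p y \<in> ball_rel E' r (p x) \<longleftrightarrow> y \<in> ball_rel E r x"
  unfolding ball_rel_def using relpow_bij_iff[OF bij edges] by simp

lemma seeds_iff: "p x \<in> seeds E' r q U \<longleftrightarrow> x \<in> seeds E r q (U \<circ> map p)"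
proof -
  have "finite (E'\<^sup>* `` {p x}) \<longleftrightarrow> finite (E\<^sup>* `` {x})"
    by (rule finite_iff) (simp add: rtrancl_bij_iff[OF bij edges])
  moreover have "(\<forall>w\<in>ball_rel E' r (p x). q \<le> U [w]) \<longleftrightarrow> (\<forall>w\<in>ball_rel E r x. q \<le> U [p w])"
    using ball_rel_iff by (metis obtain_preimage)
  ultimately show ?thesis by (simp add: seeds_def)
qed

context
  fixes S :: "'v set" and S' :: "'w set"
  assumes S: "\<And>x. p x \<in> S' \<longleftrightarrow> x \<in> S"
begin

lemma cluster_iff: "p y \<in> cluster E' S' (p x) \<longleftrightarrow> y \<in> cluster E S x"
  unfolding cluster_def mem_Collect_eq
  by (rule rtrancl_bij_iff[OF bij]) (auto simp: S edges)

lemma bridge_iff: "bridge E' m S' (map p xs) \<longleftrightarrow> bridge E m S xs"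
proof (cases "xs = []")
  case False
  have "finite (cluster E' S' (p (hd xs))) \<longleftrightarrow> finite (cluster E S (hd xs))"
    by (rule finite_iff) (rule cluster_iff)
  then show ?thesis
    using False by (simp add: bridge_def successively_map edges S hd_map last_map cluster_iff)
qed (simp add: bridge_def)

lemma min_bridge_iff:
  "min_bridge E' m U S' (map p xs) \<longleftrightarrow> min_bridge E m (U \<circ> map p) S xs"
proof (cases "xs = []")
  case False
  \<comment> \<open>\<open>hd\<close> commutes with \<open>map p\<close> only on nonempty lists; the
    empty list is no bridge on either side.\<close>
  have *: "bridge E' m S' (map p ys) \<and> hd (map p ys) \<in> cluster E' S' (p (hd xs)) \<longleftrightarrow>
      bridge E m S ys \<and> hd ys \<in> cluster E S (hd xs)" for ys
    by (cases "ys = []") (simp_all add: bridge_iff hd_map cluster_iff, simp add: bridge_def)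
  have "(\<forall>ys. bridge E' m S' ys \<and> hd ys \<in> cluster E' S' (p (hd xs)) \<longrightarrow> U (map p xs) \<le> U ys) \<longleftrightarrow>
    (\<forall>ys. bridge E m S ys \<and> hd ys \<in> cluster E S (hd xs) \<longrightarrow> U (map p xs) \<le> U (map p ys))"
    by (subst all_map_iff) (simp only: *)
  then show ?thesis using False by (simp add: min_bridge_def bridge_iff hd_map)
qed (simp add: min_bridge_def bridge_def)

lemma head_of_bridge_iff:
  "head_of_bridge E' m U S' (p x) \<longleftrightarrow> head_of_bridge E m (U \<circ> map p) S x"
proof -
  have "(min_bridge E' m U S' (map p xs) \<and> hd (map p xs) = p x) \<longleftrightarrow>
    (min_bridge E m (U \<circ> map p) S xs \<and> hd xs = x)" for xs
    using bij min_bridge_not_Nil[of E m "U \<circ> map p" S xs]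
    by (auto simp: min_bridge_iff hd_map inj_eq bij_is_inj)
  then show ?thesis unfolding head_of_bridge_def by (subst ex_map_iff) simp
qed

lemma on_bridge_iff:
  "(\<exists>xs. min_bridge E' m U S' xs \<and> hd xs = p x \<and> p y \<in> set xs) \<longleftrightarrow>
   (\<exists>xs. min_bridge E m (U \<circ> map p) S xs \<and> hd xs = x \<and> y \<in> set xs)"
proof -
  have "(min_bridge E' m U S' (map p xs) \<and> hd (map p xs) = p x \<and> p y \<in> set (map p xs)) \<longleftrightarrow>
    (min_bridge E m (U \<circ> map p) S xs \<and> hd xs = x \<and> y \<in> set xs)" for xs
    using bij min_bridge_not_Nil[of E m "U \<circ> map p" S xs]
    by (auto simp: min_bridge_iff hd_map inj_eq inj_image_mem_iff bij_is_inj)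
  then show ?thesis by (subst ex_map_iff) simp
qed

lemma grow_iff: "p x \<in> grow E' m U S' \<longleftrightarrow> x \<in> grow E m (U \<circ> map p) S"
proof -
  have "(\<exists>xs. min_bridge E' m U S' xs \<and> p x \<in> set xs) \<longleftrightarrow>
    (\<exists>xs. min_bridge E m (U \<circ> map p) S xs \<and> x \<in> set xs)"
    using bij by (subst ex_map_iff) (simp add: min_bridge_iff inj_image_mem_iff bij_is_inj)
  then show ?thesis by (simp add: grow_def S)
qed

end

lemma closed_set_iff: "p x \<in> closed_set E' r q n U \<longleftrightarrow> x \<in> closed_set E r q n (U \<circ> map p)"
  unfolding closed_set_def
  by (induction n arbitrary: x) (simp_all add: seeds_iff grow_iff)

end

section \<open>Measurability\<close>

text \<open>Finiteness of a set of naturals is boundedness, a countable combination of membership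
  events.\<close>

lemma pred_finite_nat:
  fixes A :: "'a \<Rightarrow> nat set"
  assumes [measurable]: "\<And>y. Measurable.pred M (\<lambda>c. y \<in> A c)"
  shows "Measurable.pred M (\<lambda>c. finite (A c))"
proof -
  have *: "finite (A c) \<longleftrightarrow> (\<exists>n. \<forall>y. y \<in> A c \<longrightarrow> y < n)" for c
    by (auto simp: finite_nat_iff_bounded)
  show ?thesis unfolding * by measurable
qed

text \<open>The graph varies with the sample point \<open>c\<close>. Vertices, lists and lengths
  range over countable types, so all the notions above are countable Boolean combinations of edge
  and label events.\<close>

context
  fixes M :: "'a measure" and E :: "'a \<Rightarrow> (nat \<times> nat) set"
  assumes E [measurable]: "\<And>x y. Measurable.pred M (\<lambda>c. (x, y) \<in> E c)"
begin

lemma pred_relpow [measurable]: "Measurable.pred M (\<lambda>c. (x, y) \<in> E c ^^ k)"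
proof (induction k arbitrary: y)
  case (Suc k)
  note Suc.IH [measurable]
  have *: "(x, y) \<in> E c ^^ Suc k \<longleftrightarrow> (\<exists>z. (x, z) \<in> E c ^^ k \<and> (z, y) \<in> E c)" for c by auto
  show ?case unfolding * by measurable
qed simp

lemma pred_rtrancl [measurable]: "Measurable.pred M (\<lambda>c. (x, y) \<in> (E c)\<^sup>*)"
  unfolding rtrancl_power by measurable

lemma pred_finite_component [measurable]: "Measurable.pred M (\<lambda>c. finite ((E c)\<^sup>* `` {x}))"
  by (rule pred_finite_nat) (simp, measurable)

lemma pred_ball_rel [measurable]: "Measurable.pred M (\<lambda>c. y \<in> ball_rel (E c) r x)"
  unfolding ball_rel_def mem_Collect_eq by measurable

lemma pred_successively [measurable]: "Measurable.pred M (\<lambda>c. successively (\<lambda>x y. (x, y) \<in> E c) xs)"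
  by (induction xs rule: induct_list012) auto

end

lemma pred_cluster:
  fixes E :: "'a \<Rightarrow> (nat \<times> nat) set" and S :: "'a \<Rightarrow> nat set"
  assumes [measurable]: "\<And>x y. Measurable.pred M (\<lambda>c. (x, y) \<in> E c)"
    "\<And>x. Measurable.pred M (\<lambda>c. x \<in> S c)"
  shows "Measurable.pred M (\<lambda>c. y \<in> cluster (E c) (S c) x)"
  unfolding cluster_def mem_Collect_eq by (rule pred_rtrancl) simp

context
  fixes M :: "'a measure" and E :: "'a \<Rightarrow> (nat \<times> nat) set" and U :: "'a \<Rightarrow> nat list \<Rightarrow> real"
  assumes E [measurable]: "\<And>x y. Measurable.pred M (\<lambda>c. (x, y) \<in> E c)"
    and U [measurable]: "\<And>xs. (\<lambda>c. U c xs) \<in> borel_measurable M"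
begin

lemma pred_seeds: "Measurable.pred M (\<lambda>c. x \<in> seeds (E c) r q (U c))"
proof -
  note pred_ball_rel[OF E, measurable] pred_finite_component[OF E, measurable]
  show ?thesis unfolding seeds_def mem_Collect_eq Ball_def by measurable
qed

context
  fixes S :: "'a \<Rightarrow> nat set"
  assumes S [measurable]: "\<And>x. Measurable.pred M (\<lambda>c. x \<in> S c)"
begin

lemma pred_bridge: "Measurable.pred M (\<lambda>c. bridge (E c) m (S c) xs)"
proof -
  note pred_cluster[OF E S, measurable] pred_successively[OF E, measurable]
  note pred_finite_nat[OF pred_cluster[OF E S], measurable]
  show ?thesis unfolding bridge_def by measurable
qed

lemma pred_min_bridge [measurable]: "Measurable.pred M (\<lambda>c. min_bridge (E c) m (U c) (S c) xs)"
proof -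
  note pred_cluster[OF E S, measurable] pred_bridge[measurable]
  show ?thesis unfolding min_bridge_def by measurable
qed

lemma pred_head_of_bridge: "Measurable.pred M (\<lambda>c. head_of_bridge (E c) m (U c) (S c) x)"
  unfolding head_of_bridge_def by measurable

lemma pred_on_bridge:
  "Measurable.pred M (\<lambda>c. \<exists>xs. min_bridge (E c) m (U c) (S c) xs \<and> hd xs = x \<and> y \<in> set xs)"
  by measurable

lemma pred_grow: "Measurable.pred M (\<lambda>c. x \<in> grow (E c) m (U c) (S c))"
  unfolding grow_def Un_iff mem_Collect_eq by measurable

end

lemma pred_closed_set: "Measurable.pred M (\<lambda>c. x \<in> closed_set (E c) r q n (U c))"
  unfolding closed_set_def
  by (induction n arbitrary: x) (simp_all add: pred_seeds pred_grow)

end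

section \<open>Exchangeable labels\<close>

abbreviation unif :: "real measure" where
  "unif \<equiv> uniform_measure lborel {0..1}"

text \<open>Labelling lists of vertices rather than vertices gives independent labels to the paths as well;
  the label of a vertex \<open>v\<close> is the one of \<open>[v]\<close>.\<close>

definition labels :: "(nat list \<Rightarrow> real) measure" where
  "labels = (\<Pi>\<^sub>M xs\<in>UNIV. unif)"

lemma prob_space_unif: "prob_space unif"
  by (intro prob_space_uniform_measure) auto

lemma prob_space_labels: "prob_space labels"
  unfolding labels_def by (intro prob_space_PiM prob_space_unif)

lemma space_labels [simp]: "space labels = UNIV"
  by (simp add: labels_def space_PiM)

lemma measurable_label [measurable]: "(\<lambda>U. U xs) \<in> borel_measurable labels"
proof -
  have "(\<lambda>U. U xs) \<in> measurable labels unif"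
    unfolding labels_def by (rule measurable_component_singleton) simp
  then show ?thesis by (simp cong: measurable_cong_sets)
qed

text \<open>The map \<open>map p\<close> is injective on lists, so the reindexed family consists of
  distinct coordinates of an i.i.d. family.\<close>

lemma distr_labels_reindex:
  assumes "bij p"
  shows "distr labels labels (\<lambda>U. U \<circ> map p) = labels"
proof -
  have "inj (map p)" using assms by (simp add: bij_is_inj)
  then show ?thesis
    using distr_PiM_reindex[of UNIV "\<lambda>_. unif" "map p" UNIV] prob_space_unif
    by (simp add: labels_def comp_def restrict_def)
qed

lemma measurable_reindex [measurable]: "(\<lambda>U. U \<circ> map p) \<in> measurable labels labels"
proof -
  have "(\<lambda>U xs. U (map p xs)) \<in> measurable labels (\<Pi>\<^sub>M xs\<in>UNIV. unif)"
    by (rule measurable_abs_UNIV) (simp cong: measurable_cong_sets)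
  then show ?thesis by (simp add: comp_def labels_def)
qed

lemma emeasure_unif_less:
  assumes "0 \<le> q" "q \<le> 1"
  shows "emeasure unif {..<q} = ennreal q"
proof -
  have "{0..1} \<inter> {..<q} = {0..<q}" using assms by auto
  then show ?thesis using assms by (simp add: emeasure_uniform_measure divide_ennreal_def)
qed

lemma emeasure_unif_ge:
  assumes "0 \<le> q" "q \<le> 1"
  shows "emeasure unif {q..} = ennreal (1 - q)"
proof -
  have "{0..1} \<inter> {q..} = {q..1}" using assms by auto
  then show ?thesis using assms by (simp add: emeasure_uniform_measure divide_ennreal_def)
qed

lemma emeasure_labels_less:
  assumes "0 \<le> q" "q \<le> 1"
  shows "emeasure labels {U. U xs < q} = ennreal q"
proof -
  interpret product_prob_space "\<lambda>_::nat list. unif" UNIV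
    by (simp add: product_prob_space_def product_prob_space_axioms_def product_sigma_finite_def
        prob_space_unif prob_space_imp_sigma_finite)
  have "emeasure labels {U. U xs < q} = emeasure unif {..<q}"
    using emeasure_PiM_Collect_single[of xs "{..<q}"]
    by (simp add: labels_def space_PiM)
  then show ?thesis using emeasure_unif_less[OF assms] by simp
qed

lemma emeasure_labels_ge:
  assumes "0 \<le> q" "q \<le> 1" "finite J"
  shows "emeasure labels {U. \<forall>xs\<in>J. q \<le> U xs} = ennreal ((1 - q) ^ card J)"
proof -
  interpret product_prob_space "\<lambda>_::nat list. unif" UNIV
    by (simp add: product_prob_space_def product_prob_space_axioms_def product_sigma_finite_def
        prob_space_unif prob_space_imp_sigma_finite)
  have "emeasure labels {U. \<forall>xs\<in>J. q \<le> U xs} = (\<Prod>xs\<in>J. emeasure unif {q..})"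
    using emeasure_PiM_Collect[of J "\<lambda>_. {q..}"] assms(3)
    by (simp add: labels_def space_PiM)
  then show ?thesis using emeasure_unif_ge[OF assms(1,2)] assms(2) by (simp add: ennreal_power)
qed

text \<open>Project to the two coordinates and apply Fubini: given the label of \<open>ys\<close>,
  the label of \<open>xs\<close> would have to hit a single point, which is a null set for the
  uniform law.\<close>

lemma AE_labels_neq:
  assumes "xs \<noteq> ys"
  shows "AE U in labels. U xs \<noteq> U ys"
proof -
  interpret product_prob_space "\<lambda>_::nat list. unif" UNIV
    by (simp add: product_prob_space_def product_prob_space_axioms_def product_sigma_finite_def
        prob_space_unif prob_space_imp_sigma_finite)
  let ?J = "insert xs {ys}" and ?A = "\<lambda>J. {f \<in> space (PiM J (\<lambda>_. unif)). f xs = f ys}"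
  let ?PJ = "PiM ?J (\<lambda>_. unif)"
  have m [measurable]: "(\<lambda>f. f i) \<in> borel_measurable ?PJ" if "i \<in> ?J" for i
    using measurable_component_singleton[OF that, of "\<lambda>_. unif"] by (simp cong: measurable_cong_sets)
  have A: "?A ?J \<in> sets ?PJ"
    using m[of xs] m[of ys] by measurable
  have r: "(\<lambda>f. restrict f ?J) \<in> measurable labels ?PJ"
    unfolding labels_def by (intro measurable_restrict_subset) auto
  have "distr labels ?PJ (\<lambda>f. restrict f ?J) = ?PJ"
    unfolding labels_def by (rule distr_PiM_restrict_finite) auto
  then have "emeasure labels {U \<in> space labels. U xs = U ys} = emeasure ?PJ (?A ?J)"
    using emeasure_distr[OF r A] by (simp add: vimage_def space_PiM)
  also have "\<dots> = (\<integral>\<^sup>+ f. indicator (?A ?J) f \<partial>?PJ)" using A by simp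
  \<comment> \<open>The coordinate \<open>xs\<close> is integrated first, with the label of
    \<open>ys\<close> frozen.\<close>
  also have "\<dots> = (\<integral>\<^sup>+ f. (\<integral>\<^sup>+ y. indicator (?A ?J) (f(xs := y)) \<partial>unif) \<partial>PiM {ys} (\<lambda>_. unif))"
    using assms A by (intro product_nn_integral_insert) auto
  also have "\<dots> = (\<integral>\<^sup>+ f. 0 \<partial>PiM {ys} (\<lambda>_. unif))"
  proof (intro nn_integral_cong)
    fix f assume "f \<in> space (PiM {ys} (\<lambda>_. unif))"
    have "(\<integral>\<^sup>+ y. indicator (?A ?J) (f(xs := y)) \<partial>unif) \<le> (\<integral>\<^sup>+ y. indicator {f ys} y \<partial>unif)"
      using assms by (intro nn_integral_mono) (auto simp: indicator_def)
    also have "\<dots> = 0"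
      using emeasure_eq_0[of "{f ys}" lborel "{0..1} \<inter> {f ys}"]
      by (simp add: emeasure_uniform_measure)
    finally show "(\<integral>\<^sup>+ y. indicator (?A ?J) (f(xs := y)) \<partial>unif) = 0" by simp
  qed
  finally have "emeasure labels {U \<in> space labels. U xs = U ys} = 0" by simp
  moreover have "{U \<in> space labels. U xs = U ys} \<in> sets labels" by measurable
  ultimately show ?thesis by (intro AE_I[of _ _ "{U \<in> space labels. U xs = U ys}"]) auto
qed

lemma AE_labels_inj: "AE U in labels. inj U"
proof -
  have "AE U in labels. \<forall>xs ys. xs \<noteq> ys \<longrightarrow> U xs \<noteq> U ys"
    by (intro AE_all_countable[THEN iffD2] allI) (auto intro: AE_labels_neq)
  then show ?thesis by eventually_elim (auto simp: inj_def)
qed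

section \<open>Random marked graphs\<close>

lemma measurable_nested_component:
  "(\<lambda>h. h x y) \<in> measurable (\<Pi>\<^sub>M x\<in>UNIV. \<Pi>\<^sub>M y\<in>UNIV. count_space UNIV) (count_space UNIV)"
  by (rule measurable_compose[of "\<lambda>h. h x" _ "\<Pi>\<^sub>M y\<in>UNIV. count_space UNIV"])
     (auto intro!: measurable_component_singleton)

lemma measurable_gV [measurable]: "(\<lambda>g. gV g x) \<in> measurable MG (count_space UNIV)"
  unfolding gV_def MG_def
  by (rule measurable_compose[OF measurable_fst]) (auto intro!: measurable_component_singleton)

lemma measurable_gE [measurable]: "(\<lambda>g. gE g x y) \<in> measurable MG (count_space UNIV)"
  unfolding gE_def MG_def
  by (rule measurable_compose[OF measurable_compose[OF measurable_snd measurable_fst]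
        measurable_nested_component])

lemma measurable_gvm [measurable]: "(\<lambda>g. gvm g x) \<in> measurable MG (count_space UNIV)"
  unfolding gvm_def MG_def
  by (rule measurable_compose[OF measurable_compose[OF measurable_snd
        measurable_compose[OF measurable_snd measurable_fst]]])
     (auto intro!: measurable_component_singleton)

lemma measurable_gem [measurable]: "(\<lambda>g. gem g x y) \<in> measurable MG (count_space UNIV)"
  unfolding gem_def MG_def
  by (rule measurable_compose[OF measurable_compose[OF measurable_snd
        measurable_compose[OF measurable_snd measurable_snd]] measurable_nested_component])

lemma measurable_into_MG:
  assumes "\<And>x. (\<lambda>c. v c x) \<in> measurable M (count_space UNIV)"
    "\<And>x y. (\<lambda>c. e c x y) \<in> measurable M (count_space UNIV)"
    "\<And>x. (\<lambda>c. a c x) \<in> measurable M (count_space UNIV)"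
    "\<And>x y. (\<lambda>c. b c x y) \<in> measurable M (count_space UNIV)"
  shows "(\<lambda>c. (v c, e c, a c, b c)) \<in> measurable M MG"
  unfolding MG_def
  by (intro measurable_Pair measurable_abs_UNIV[where N = "\<lambda>_. count_space UNIV"]
      measurable_abs_UNIV[where N = "\<lambda>_. \<Pi>\<^sub>M y\<in>UNIV. count_space UNIV"] assms)

lemma space_MG [simp]: "space MG = UNIV"
  by (auto simp: MG_def space_pair_measure space_PiM)

text \<open>The roots take countably many values, so measurability for each fixed pair of roots
  gives joint measurability.\<close>

lemma measurable_from_countable_pairs:
  fixes h :: "'a \<Rightarrow> nat \<Rightarrow> nat \<Rightarrow> 'b"
  assumes "\<And>x y. (\<lambda>g. h g x y) \<in> measurable M N"
  shows "(\<lambda>(g, x, y). h g x y) \<in> measurable (M \<Otimes>\<^sub>M (count_space UNIV \<Otimes>\<^sub>M count_space UNIV)) N"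
proof -
  let ?M = "M \<Otimes>\<^sub>M ((count_space UNIV :: nat measure) \<Otimes>\<^sub>M (count_space UNIV :: nat measure))"
  have x: "(\<lambda>z. fst (snd z)) \<in> measurable ?M (count_space UNIV)"
    by (rule measurable_compose[OF measurable_snd measurable_fst])
  have y: "(\<lambda>z. snd (snd z)) \<in> measurable ?M (count_space UNIV)"
    by (rule measurable_compose[OF measurable_snd measurable_snd])
  have 1: "(\<lambda>z. h (fst z) (fst (snd z)) b) \<in> measurable ?M N" for b
    by (rule measurable_compose_countable[OF measurable_compose[OF measurable_fst assms] x])
  have "(\<lambda>z. h (fst z) (fst (snd z)) (snd (snd z))) \<in> measurable ?M N"
    by (rule measurable_compose_countable[OF 1 y])
  then show ?thesis by (simp add: case_prod_unfold)
qed

text \<open>Averaging a diagonally invariant transport over the labels gives an isomorphism-invariant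
  one, since the law of the labels is exchangeable.\<close>

lemma mass_transport_labels:
  fixes P :: "(('m, 'e) mgraph \<times> nat) measure"
    and F :: "('m, 'e) mgraph \<Rightarrow> (nat list \<Rightarrow> real) \<Rightarrow> nat \<Rightarrow> nat \<Rightarrow> ennreal"
  assumes P: "unimodular_rrg P"
    and meas [measurable]: "\<And>x y. (\<lambda>(g, U). F g U x y) \<in> borel_measurable (MG \<Otimes>\<^sub>M labels)"
    and inv: "\<And>p g U x y. bij p \<Longrightarrow> F (relabel p g) U (p x) (p y) = F g (U \<circ> map p) x y"
  shows "(\<integral>\<^sup>+ c. (\<Sum>w. if gV (fst (fst c)) w then F (fst (fst c)) (snd c) (snd (fst c)) w else 0)
            \<partial>(P \<Otimes>\<^sub>M labels)) =
         (\<integral>\<^sup>+ c. (\<Sum>w. if gV (fst (fst c)) w then F (fst (fst c)) (snd c) w (snd (fst c)) else 0)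
            \<partial>(P \<Otimes>\<^sub>M labels))"
proof -
  interpret L: prob_space labels by (rule prob_space_labels)
  have sP: "sets P = sets (MG \<Otimes>\<^sub>M count_space UNIV)" using P by (simp add: unimodular_rrg_def)
  note [measurable_cong] = sP
  define f where "f = (\<lambda>(g, x, y). \<integral>\<^sup>+ U. F g U x y \<partial>labels)"
  have slice: "(\<lambda>g. \<integral>\<^sup>+ U. F g U x y \<partial>labels) \<in> borel_measurable MG" for x y
    using meas[of x y] by (rule L.borel_measurable_nn_integral)
  have f_meas: "f \<in> borel_measurable (MG \<Otimes>\<^sub>M (count_space UNIV \<Otimes>\<^sub>M count_space UNIV))"
    unfolding f_def by (rule measurable_from_countable_pairs[OF slice])
  have f_inv: "iso_invariant f"
    unfolding iso_invariant_def
  proof (intro allI impI)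
    fix p :: "nat \<Rightarrow> nat" and g :: "('m, 'e) mgraph" and x y :: nat
    assume p: "bij p"
    have Fg: "(\<lambda>U. F g U x y) \<in> borel_measurable labels"
      using measurable_compose[OF measurable_Pair1' meas[of x y], of g] by simp
    have "f (relabel p g, p x, p y) = (\<integral>\<^sup>+ U. F g (U \<circ> map p) x y \<partial>labels)"
      by (simp add: f_def inv[OF p])
    also have "\<dots> = (\<integral>\<^sup>+ U. F g U x y \<partial>distr labels labels (\<lambda>U. U \<circ> map p))"
      using Fg by (simp add: nn_integral_distr)
    also have "\<dots> = f (g, x, y)" by (simp add: f_def distr_labels_reindex[OF p])
    finally show "f (relabel p g, p x, p y) = f (g, x, y)" .
  qed
  \<comment> \<open>Fubini and monotone convergence move the integral over the labels inside the
    sum. This is shown for an arbitrary \<open>H\<close> because it is needed both for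
    \<open>F\<close> and for \<open>F\<close> with its two vertices exchanged.\<close>
  have avg: "(\<integral>\<^sup>+ c. (\<Sum>w. if gV (fst (fst c)) w then H (fst (fst c)) (snd c) (snd (fst c)) w else 0)
            \<partial>(P \<Otimes>\<^sub>M labels)) =
     (\<integral>\<^sup>+ z. (\<Sum>w. if gV (fst z) w then \<integral>\<^sup>+ U. H (fst z) U (snd z) w \<partial>labels else 0) \<partial>P)"
    if [measurable]: "\<And>x y. (\<lambda>(g, U). H g U x y) \<in> borel_measurable (MG \<Otimes>\<^sub>M labels)"
    for H :: "('m, 'e) mgraph \<Rightarrow> (nat list \<Rightarrow> real) \<Rightarrow> nat \<Rightarrow> nat \<Rightarrow> ennreal"
  proof -
    have Hm: "(\<lambda>c. H (fst (fst c)) (snd c) (snd (fst c)) w) \<in> borel_measurable (P \<Otimes>\<^sub>M labels)" for w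
    proof (rule measurable_compose_countable[where f = "\<lambda>x c. H (fst (fst c)) (snd c) x w"])
      fix x
      have "(\<lambda>c. (fst (fst c), snd c)) \<in> measurable (P \<Otimes>\<^sub>M labels) (MG \<Otimes>\<^sub>M labels)"
        by measurable
      from measurable_compose[OF this that[of x w]]
      show "(\<lambda>c. H (fst (fst c)) (snd c) x w) \<in> borel_measurable (P \<Otimes>\<^sub>M labels)" by simp
    qed measurable
    note [measurable] = this
    have Hz: "(\<lambda>U. H (fst z) U (snd z) w) \<in> borel_measurable labels" for z w
      using measurable_compose[OF measurable_Pair1' that[of "snd z" w], of "fst z"] by simp
    have "(\<integral>\<^sup>+ c. (\<Sum>w. if gV (fst (fst c)) w then H (fst (fst c)) (snd c) (snd (fst c)) w else 0)
            \<partial>(P \<Otimes>\<^sub>M labels)) =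
      (\<integral>\<^sup>+ z. \<integral>\<^sup>+ U. (\<Sum>w. if gV (fst z) w then H (fst z) U (snd z) w else 0) \<partial>labels \<partial>P)"
      by (subst L.nn_integral_fst[symmetric]) (measurable, simp cong: if_cong)
    also have "\<dots> = (\<integral>\<^sup>+ z. (\<Sum>w. if gV (fst z) w then \<integral>\<^sup>+ U. H (fst z) U (snd z) w \<partial>labels else 0) \<partial>P)"
    proof (intro nn_integral_cong)
      fix z
      have "(\<integral>\<^sup>+ U. (\<Sum>w. if gV (fst z) w then H (fst z) U (snd z) w else 0) \<partial>labels) =
        (\<Sum>w. \<integral>\<^sup>+ U. (if gV (fst z) w then H (fst z) U (snd z) w else 0) \<partial>labels)"
        by (rule nn_integral_suminf) (simp add: Hz)
      also have "\<dots> = (\<Sum>w. if gV (fst z) w then \<integral>\<^sup>+ U. H (fst z) U (snd z) w \<partial>labels else 0)"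
        by (intro suminf_cong) simp
      finally show "(\<integral>\<^sup>+ U. (\<Sum>w. if gV (fst z) w then H (fst z) U (snd z) w else 0) \<partial>labels) =
        (\<Sum>w. if gV (fst z) w then \<integral>\<^sup>+ U. H (fst z) U (snd z) w \<partial>labels else 0)" .
    qed
    finally show ?thesis .
  qed
  have "unimodular P" using P by (simp add: unimodular_rrg_def)
  then have "(\<integral>\<^sup>+ z. (\<Sum>w. if gV (fst z) w then f (fst z, snd z, w) else 0) \<partial>P) =
       (\<integral>\<^sup>+ z. (\<Sum>w. if gV (fst z) w then f (fst z, w, snd z) else 0) \<partial>P)"
    using f_meas f_inv by (auto simp: unimodular_def)
  then show ?thesis
    using avg[of F] avg[of "\<lambda>g U x y. F g U y x"] meas by (simp add: f_def cong: if_cong)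
qed

section \<open>Densities of the stages\<close>

lemma locally_finite_pE:
  assumes "wf_graph g"
  shows "locally_finite_graph (pE g)"
proof
  show "sym (pE g)" using assms unfolding wf_graph_def pE_def sym_def by fastforce
  fix x
  have "pE g `` {x} \<subseteq> {y. gE g x y}" by (auto simp: pE_def)
  then show "finite (pE g `` {x})" using assms finite_subset unfolding wf_graph_def by blast
qed

lemma relabel_simps:
  assumes "bij p"
  shows "gV (relabel p g) (p x) = gV g x" "gE (relabel p g) (p x) (p y) = gE g x y"
    "gvm (relabel p g) (p x) = gvm g x" "gem (relabel p g) (p x) (p y) = gem g x y"
  using assms by (simp_all add: relabel_def Let_def gV_def gE_def gvm_def gem_def bij_is_inj)

lemma relabelling_pE: "bij p \<Longrightarrow> relabelling p (pE g) (pE (relabel p g))"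
  by unfold_locales (simp_all add: pE_def pV_def relabel_simps)

lemma pred_pV [measurable]: "Measurable.pred MG (\<lambda>g. x \<in> pV g)"
  unfolding pV_def mem_Collect_eq by measurable

lemma pred_pE [measurable]: "Measurable.pred MG (\<lambda>g. (x, y) \<in> pE g)"
  unfolding pE_def mem_Collect_eq case_prod_conv by measurable

lemma pcomp_eq: "pcomp g v = (pE g)\<^sup>* `` {v}"
  by (auto simp: pcomp_def)

text \<open>A vertex with an infinite component has at least one edge in \<open>pE g\<close>, and
  such edges have open endpoints.\<close>

lemma net_subset_pV: "net (pE g) r S \<Longrightarrow> S \<subseteq> pV g"
proof
  fix x assume "net (pE g) r S" "x \<in> S"
  then have "infinite ((pE g)\<^sup>* `` {x})" by (auto simp: net_def)
  then have "\<not> (pE g)\<^sup>* `` {x} \<subseteq> {x}" by (meson finite.simps finite_subset)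
  then obtain y where y: "(x, y) \<in> (pE g)\<^sup>*" "x \<noteq> y" by blast
  from y(1) show "x \<in> pV g"
  proof (cases rule: converse_rtranclE)
    case base
    then show ?thesis using y(2) by simp
  next
    case (step z)
    then show ?thesis by (simp add: pE_def)
  qed
qed

lemma pV_imp_gV: "x \<in> pV g \<Longrightarrow> gV g x"
  by (simp add: pV_def)

lemma suminf_le_card:
  fixes f :: "nat \<Rightarrow> ennreal"
  assumes "finite A" "card A \<le> k" "\<And>w. f w \<le> 1" "\<And>w. w \<notin> A \<Longrightarrow> f w = 0"
  shows "(\<Sum>w. f w) \<le> of_nat k"
proof -
  have "(\<Sum>w. f w) = (\<Sum>w\<in>A. f w)" by (rule suminf_finite) (use assms in auto)
  also have "\<dots> \<le> of_nat (card A)" using sum_bounded_above[of A f 1] assms by simp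
  also have "\<dots> \<le> of_nat k" using assms(2) by (rule of_nat_mono)
  finally show ?thesis .
qed

lemma sum_le_suminf_ennreal:
  fixes f :: "nat \<Rightarrow> ennreal"
  assumes "finite A"
  shows "sum f A \<le> (\<Sum>w. f w)"
  by (rule sum_le_suminf) (use assms in auto)

text \<open>By Bernoulli \<open>1 / q \<le> n * q \<le> (1 + q) ^ n\<close>, and
  \<open>(1 - q) * (1 + q) \<le> 1\<close> turns this into an upper bound for
  \<open>(1 - q) ^ n\<close>. It bounds the probability that a ball of \<open>n\<close> vertices
  contains no label below \<open>q\<close>.\<close>

lemma power_le_of_inverse_square:
  fixes q :: real
  assumes "0 < q" "q \<le> 1" "1 / q\<^sup>2 \<le> real n"
  shows "(1 - q) ^ n \<le> q"
proof -
  have "1 / q \<le> real n * q"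
    using assms by (simp add: field_simps power2_eq_square)
  also have "\<dots> \<le> (1 + q) ^ n"
    using Bernoulli_inequality[of q n] assms(1) by simp
  finally have 1: "1 \<le> q * (1 + q) ^ n" using assms(1) by (simp add: field_simps)
  have "0 \<le> (1 - q) * (1 + q)" "(1 - q) * (1 + q) \<le> 1"
    using assms by (simp, simp add: algebra_simps)
  then have "((1 - q) * (1 + q)) ^ n \<le> 1" by (rule power_le_one)
  then have "(1 - q) ^ n * (1 + q) ^ n \<le> q * (1 + q) ^ n"
    using 1 by (simp add: power_mult_distrib)
  then show ?thesis using assms(1) by simp
qed

lemma measurable_if_pred:
  "Measurable.pred M Q \<Longrightarrow> (\<lambda>c. if Q c then 1 else 0 :: ennreal) \<in> borel_measurable M"
  by measurable

section \<open>Mass transport between consecutive stages on the labelled random graph\<close>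

locale labelled_percolation =
  fixes P :: "((bool, bool) mgraph \<times> nat) measure" and r :: nat and q :: real
  assumes unimod: "unimodular_rrg P"
begin

text \<open>A sample \<open>c\<close> consists of the graph \<open>fst (fst c)\<close>, its root
  \<open>snd (fst c)\<close> and the labels \<open>snd c\<close>, which are independent of the
  rooted graph.\<close>

abbreviation PL where "PL \<equiv> P \<Otimes>\<^sub>M labels"

abbreviation m where "m \<equiv> 2 * r + 2"

definition stage :: "nat \<Rightarrow> (bool, bool) mgraph \<Rightarrow> (nat list \<Rightarrow> real) \<Rightarrow> nat set" where
  "stage n g U = closed_set (pE g) r q n U"

definition rep :: "nat \<Rightarrow> (bool, bool) mgraph \<Rightarrow> (nat list \<Rightarrow> real) \<Rightarrow> nat \<Rightarrow> bool" where
  "rep n g U = head_of_bridge (pE g) m U (stage n g U)"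

text \<open>The transport that charges the vertices of a bridge to the representative of the cluster
  that chose it.\<close>

definition spans :: "nat \<Rightarrow> (bool, bool) mgraph \<Rightarrow> (nat list \<Rightarrow> real) \<Rightarrow> nat \<Rightarrow> nat \<Rightarrow> bool" where
  "spans n g U x y \<longleftrightarrow>
     (\<exists>xs. min_bridge (pE g) m U (stage n g U) xs \<and> hd xs = x \<and> y \<in> set xs)"

text \<open>The transport from the representative of an old finite cluster to that of the finite new
  cluster absorbing it.\<close>

definition merges :: "nat \<Rightarrow> (bool, bool) mgraph \<Rightarrow> (nat list \<Rightarrow> real) \<Rightarrow> nat \<Rightarrow> nat \<Rightarrow> bool" where
  "merges n g U x y \<longleftrightarrow> rep n g U x \<and> rep (Suc n) g U y \<and>
     x \<in> cluster (pE g) (stage (Suc n) g U) y"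

text \<open>For the measurable properties used here, the probability that the root has the property;
  it is kept as an \<open>ennreal\<close> integral to fit the mass transport principle.\<close>

definition density ::
  "((bool, bool) mgraph \<Rightarrow> (nat list \<Rightarrow> real) \<Rightarrow> nat \<Rightarrow> bool) \<Rightarrow> ennreal" where
  "density \<phi> = (\<integral>\<^sup>+ c. (if \<phi> (fst (fst c)) (snd c) (snd (fst c)) then 1 else 0) \<partial>PL)"

definition in_stage where "in_stage n g U x \<longleftrightarrow> x \<in> stage n g U"

lemma sets_P [measurable_cong]: "sets P = sets (MG \<Otimes>\<^sub>M count_space UNIV)"
  using unimod by (simp add: unimodular_rrg_def)

lemma prob_space_P: "prob_space P"
  using unimod by (simp add: unimodular_rrg_def)

sublocale pair_prob_space P labels
  using prob_space_P prob_space_labels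
  by (simp add: pair_prob_space_def pair_sigma_finite_def prob_space_imp_sigma_finite)

lemma stage_iff: "bij p \<Longrightarrow> p x \<in> stage n (relabel p g) U \<longleftrightarrow> x \<in> stage n g (U \<circ> map p)"
  unfolding stage_def by (rule relabelling.closed_set_iff[OF relabelling_pE])

lemma rep_iff: "bij p \<Longrightarrow> rep n (relabel p g) U (p x) \<longleftrightarrow> rep n g (U \<circ> map p) x"
  unfolding rep_def by (rule relabelling.head_of_bridge_iff[OF relabelling_pE stage_iff])

lemma spans_iff:
  "bij p \<Longrightarrow> spans n (relabel p g) U (p x) (p y) \<longleftrightarrow> spans n g (U \<circ> map p) x y"
  unfolding spans_def by (rule relabelling.on_bridge_iff[OF relabelling_pE stage_iff])

lemma merges_iff:
  "bij p \<Longrightarrow> merges n (relabel p g) U (p x) (p y) \<longleftrightarrow> merges n g (U \<circ> map p) x y"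
  unfolding merges_def by (simp add: rep_iff relabelling.cluster_iff[OF relabelling_pE stage_iff] comp_def)

lemma pred_pE_fst: "Measurable.pred (MG \<Otimes>\<^sub>M labels) (\<lambda>c. (x, y) \<in> pE (fst c))"
  by measurable

lemma pred_label_snd: "(\<lambda>c. snd c xs) \<in> borel_measurable (MG \<Otimes>\<^sub>M labels)"
  by measurable

lemma pred_stage [measurable]:
  "Measurable.pred (MG \<Otimes>\<^sub>M labels) (\<lambda>c. x \<in> stage n (fst c) (snd c))"
  unfolding stage_def by (rule pred_closed_set[OF pred_pE_fst pred_label_snd])

lemma pred_rep [measurable]: "Measurable.pred (MG \<Otimes>\<^sub>M labels) (\<lambda>c. rep n (fst c) (snd c) x)"
  unfolding rep_def by (rule pred_head_of_bridge[OF pred_pE_fst pred_label_snd pred_stage])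

lemma pred_spans [measurable]: "Measurable.pred (MG \<Otimes>\<^sub>M labels) (\<lambda>c. spans n (fst c) (snd c) x y)"
  unfolding spans_def by (rule pred_on_bridge[OF pred_pE_fst pred_label_snd pred_stage])

lemma pred_merges [measurable]: "Measurable.pred (MG \<Otimes>\<^sub>M labels) (\<lambda>c. merges n (fst c) (snd c) x y)"
proof -
  note pred_cluster[OF pred_pE_fst pred_stage, measurable]
  show ?thesis unfolding merges_def by measurable
qed

lemma measurable_forget_root_label:
  "(\<lambda>c. (fst (fst c), snd c)) \<in> measurable PL (MG \<Otimes>\<^sub>M labels)"
  by measurable

lemma pred_at_root:
  assumes "\<And>x. Measurable.pred (MG \<Otimes>\<^sub>M labels) (\<lambda>c. \<phi> (fst c) (snd c) x)"
  shows "Measurable.pred PL (\<lambda>c. \<phi> (fst (fst c)) (snd c) (snd (fst c)))"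
proof (rule measurable_compose_countable[where f = "\<lambda>x c. \<phi> (fst (fst c)) (snd c) x"])
  fix x
  show "Measurable.pred PL (\<lambda>c. \<phi> (fst (fst c)) (snd c) x)"
    using measurable_compose[OF measurable_forget_root_label assms[of x]] by simp
qed measurable

lemma pred_in_stage: "Measurable.pred (MG \<Otimes>\<^sub>M labels) (\<lambda>c. in_stage n (fst c) (snd c) x)"
  unfolding in_stage_def by measurable

lemma AE_fst:
  assumes "AE z in P. \<phi> z"
  shows "AE c in PL. \<phi> (fst c)"
proof -
  from assms obtain A where A: "{z \<in> space P. \<not> \<phi> z} \<subseteq> A" "A \<in> sets P" "emeasure P A = 0"
    by (auto elim: AE_E)
  have "emeasure PL (A \<times> space labels) = 0"
    using A sets.top[of labels] by (simp add: M2.emeasure_pair_measure_Times del: sets.top)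
  moreover have "A \<times> space labels \<in> sets PL"
    using A(2) sets.top by (rule pair_measureI)
  ultimately show ?thesis
    using A(1) by (intro AE_I[of _ _ "A \<times> space labels"]) (auto simp: space_pair_measure)
qed

lemma AE_snd:
  assumes "AE U in labels. \<phi> U"
  shows "AE c in PL. \<phi> (snd c)"
proof -
  from assms obtain A where A: "{U \<in> space labels. \<not> \<phi> U} \<subseteq> A" "A \<in> sets labels" "emeasure labels A = 0"
    by (auto elim: AE_E)
  have "emeasure PL (space P \<times> A) = 0"
    using A sets.top[of labels] by (simp add: M2.emeasure_pair_measure_Times del: sets.top)
  moreover have "space P \<times> A \<in> sets PL"
    using sets.top A(2) by (rule pair_measureI)
  ultimately show ?thesis
    using A(1) by (intro AE_I[of _ _ "space P \<times> A"]) (auto simp: space_pair_measure)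
qed

lemma AE_good: "AE c in PL. wf_graph (fst (fst c)) \<and> inj (snd c)"
proof -
  have "AE z in P. wf_graph (fst z)" using unimod by (auto simp: unimodular_rrg_def)
  from AE_fst[OF this] AE_snd[OF AE_labels_inj] show ?thesis by eventually_elim simp
qed

lemma net_stage: "wf_graph g \<Longrightarrow> net (pE g) r (stage n g U)"
  unfolding stage_def closed_set_def
  by (intro locally_finite_graph.net_grow_iterate locally_finite_graph.net_seeds locally_finite_pE)

lemma stage_Suc: "stage (Suc n) g U = grow (pE g) m U (stage n g U)"
  by (simp add: stage_def closed_set_def)

lemma stage_gV: "wf_graph g \<Longrightarrow> x \<in> stage n g U \<Longrightarrow> gV g x"
  using net_subset_pV[OF net_stage] pV_imp_gV by blast

lemma rep_stage: "rep n g U x \<Longrightarrow> x \<in> stage n g U"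
  by (auto simp: rep_def head_of_bridge_def min_bridge_def bridge_def)

text \<open>Mass transport for unit masses: \<open>into\<close> is a lower bound for the mass
  received and \<open>out\<close> an upper bound for the mass sent. The bounds are asked only on
  well-formed graphs with injective labels, which is an almost sure event.\<close>

lemma mass_transport_pred:
  assumes "\<And>x y. Measurable.pred (MG \<Otimes>\<^sub>M labels) (\<lambda>c. \<tau> (fst c) (snd c) x y)"
    and "\<And>p g U x y. bij p \<Longrightarrow> \<tau> (relabel p g) U (p x) (p y) \<longleftrightarrow> \<tau> g (U \<circ> map p) x y"
    and out: "\<And>g U x. wf_graph g \<Longrightarrow> inj U \<Longrightarrow>
      (\<Sum>w. if gV g w \<and> \<tau> g U x w then 1 else 0) \<le> out g U x"
    and into: "\<And>g U x. wf_graph g \<Longrightarrow> inj U \<Longrightarrow>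
      into g U x \<le> (\<Sum>w. if gV g w \<and> \<tau> g U w x then 1 else 0)"
  shows "(\<integral>\<^sup>+ c. into (fst (fst c)) (snd c) (snd (fst c)) \<partial>PL) \<le>
    (\<integral>\<^sup>+ c. (out (fst (fst c)) (snd c) (snd (fst c)) :: ennreal) \<partial>PL)"
proof -
  have if_if: "(if a then if b then 1 else 0 else 0) = (if a \<and> b then 1 else (0 :: ennreal))" for a b
    by simp
  have "(\<integral>\<^sup>+ c. into (fst (fst c)) (snd c) (snd (fst c)) \<partial>PL) \<le>
    (\<integral>\<^sup>+ c. (\<Sum>w. if gV (fst (fst c)) w \<and> \<tau> (fst (fst c)) (snd c) w (snd (fst c)) then 1 else 0) \<partial>PL)"
    by (intro nn_integral_mono_AE) (use AE_good in eventually_elim, auto intro: into)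
  also have "\<dots> =
    (\<integral>\<^sup>+ c. (\<Sum>w. if gV (fst (fst c)) w \<and> \<tau> (fst (fst c)) (snd c) (snd (fst c)) w then 1 else 0) \<partial>PL)"
    using mass_transport_labels[OF unimod, of "\<lambda>g U x y. if \<tau> g U x y then 1 else 0"] assms(1,2)
    by (simp add: if_if case_prod_unfold)
  also have "\<dots> \<le> (\<integral>\<^sup>+ c. out (fst (fst c)) (snd c) (snd (fst c)) \<partial>PL)"
    by (intro nn_integral_mono_AE) (use AE_good in eventually_elim, auto intro: out)
  finally show ?thesis .
qed

text \<open>Each representative sends mass 1 to every vertex of its bridge. It sends at most
  \<open>m\<close>, as its minimal bridge is unique, and every newly added vertex receives at least
  1.\<close>

lemma density_stage_Suc:
  "density (in_stage (Suc n)) \<le> density (in_stage n) + of_nat m * density (rep n)"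
proof -
  let ?new = "\<lambda>g U x. if x \<in> stage (Suc n) g U \<and> x \<notin> stage n g U then 1 else (0 :: ennreal)"
  have mr: "Measurable.pred PL (\<lambda>c. rep n (fst (fst c)) (snd c) (snd (fst c)))"
    by (rule pred_at_root[OF pred_rep])
  have mc: "Measurable.pred PL (\<lambda>c. snd (fst c) \<in> stage k (fst (fst c)) (snd c))" for k
    by (rule pred_at_root[OF pred_stage])
  have "(\<integral>\<^sup>+ c. ?new (fst (fst c)) (snd c) (snd (fst c)) \<partial>PL) \<le>
    (\<integral>\<^sup>+ c. of_nat m * (if rep n (fst (fst c)) (snd c) (snd (fst c)) then 1 else 0) \<partial>PL)"
  proof (rule mass_transport_pred[where \<tau> = "spans n", OF pred_spans spans_iff])
    fix g :: "(bool, bool) mgraph" and U :: "nat list \<Rightarrow> real" and x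
    assume g: "wf_graph g" and U: "inj U"
    interpret locally_finite_graph "pE g" using g by (rule locally_finite_pE)
    show "(\<Sum>w. if gV g w \<and> spans n g U x w then 1 else 0)
      \<le> of_nat m * (if rep n g U x then 1 else (0 :: ennreal))"
    proof (cases "rep n g U x")
      case True
      then obtain xs where xs: "min_bridge (pE g) m U (stage n g U) xs" "hd xs = x"
        by (auto simp: rep_def head_of_bridge_def)
      have "w \<in> set xs" if w: "spans n g U x w" for w
      proof -
        obtain ys where ys: "min_bridge (pE g) m U (stage n g U) ys" "hd ys = x" "w \<in> set ys"
          using w unfolding spans_def by blast
        have "hd ys \<in> cluster (pE g) (stage n g U) (hd xs)" using xs(2) ys(2) by simp
        from min_bridge_unique[OF U xs(1) ys(1) this] show ?thesis using ys(3) by simp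
      qed
      then have "(\<Sum>w. if gV g w \<and> spans n g U x w then 1 else (0 :: ennreal)) \<le> of_nat m"
        using order_trans[OF card_length, of xs m] xs(1) unfolding min_bridge_def bridge_def
        by (intro suminf_le_card[of "set xs"]) auto
      then show ?thesis using True by simp
    next
      case False
      then have "\<not> spans n g U x w" for w
        unfolding spans_def rep_def head_of_bridge_def by blast
      then show ?thesis by simp
    qed
    show "?new g U x \<le> (\<Sum>w. if gV g w \<and> spans n g U w x then 1 else 0)"
    proof (cases "x \<in> stage (Suc n) g U \<and> x \<notin> stage n g U")
      case True
      then obtain xs where xs: "min_bridge (pE g) m U (stage n g U) xs" "x \<in> set xs"
        unfolding stage_Suc grow_def by blast
      then have "spans n g U (hd xs) x" unfolding spans_def by blast
      moreover have "gV g (hd xs)"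
        using stage_gV[OF g] xs(1) unfolding min_bridge_def bridge_def by blast
      moreover note True
      ultimately show ?thesis
        using sum_le_suminf_ennreal[of "{hd xs}" "\<lambda>w. if gV g w \<and> spans n g U w x then 1 else 0"]
        by simp
    qed auto
  qed auto
  also have "\<dots> = of_nat m * density (rep n)"
    unfolding density_def by (intro nn_integral_cmult measurable_if_pred mr)
  finally have *: "(\<integral>\<^sup>+ c. ?new (fst (fst c)) (snd c) (snd (fst c)) \<partial>PL) \<le> of_nat m * density (rep n)" .
  have "density (in_stage (Suc n)) \<le>
    (\<integral>\<^sup>+ c. (if snd (fst c) \<in> stage n (fst (fst c)) (snd c) then 1 else 0) +
       ?new (fst (fst c)) (snd c) (snd (fst c)) \<partial>PL)"
    unfolding density_def in_stage_def by (intro nn_integral_mono) auto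
  also have "\<dots> = density (in_stage n) + (\<integral>\<^sup>+ c. ?new (fst (fst c)) (snd c) (snd (fst c)) \<partial>PL)"
    unfolding density_def in_stage_def
    by (intro nn_integral_add measurable_if_pred pred_intros_logic mc)
  finally show ?thesis using * by (meson add_left_mono order_trans)
qed

text \<open>Each old representative sends mass 1 along \<open>merges\<close>. It sends at most 1,
  because the new cluster has a unique representative, and by
  \<open>grow_cluster_contains_two\<close> each new representative receives at least 2.\<close>

lemma density_rep_Suc: "2 * density (rep (Suc n)) \<le> density (rep n)"
proof -
  have mr: "Measurable.pred PL (\<lambda>c. rep k (fst (fst c)) (snd c) (snd (fst c)))" for k
    by (rule pred_at_root[OF pred_rep])
  have "2 * density (rep (Suc n)) =
    (\<integral>\<^sup>+ c. 2 * (if rep (Suc n) (fst (fst c)) (snd c) (snd (fst c)) then 1 else 0) \<partial>PL)"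
    unfolding density_def by (intro nn_integral_cmult[symmetric] measurable_if_pred mr)
  also have "\<dots> \<le> (\<integral>\<^sup>+ c. (if rep n (fst (fst c)) (snd c) (snd (fst c)) then 1 else 0) \<partial>PL)"
  proof (rule mass_transport_pred[where \<tau> = "merges n", OF pred_merges merges_iff])
    fix g :: "(bool, bool) mgraph" and U :: "nat list \<Rightarrow> real" and x
    assume g: "wf_graph g" and U: "inj U"
    interpret locally_finite_graph "pE g" using g by (rule locally_finite_pE)
    show "(\<Sum>w. if gV g w \<and> merges n g U x w then 1 else 0) \<le> (if rep n g U x then 1 else (0 :: ennreal))"
    proof (cases "\<exists>w. merges n g U x w")
      case True
      then obtain w where w: "merges n g U x w" by blast
      have "w' = w" if w': "merges n g U x w'" for w'
      proof -
        from w w' obtain xs ys where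
          "min_bridge (pE g) m U (stage (Suc n) g U) xs" "hd xs = w"
          "min_bridge (pE g) m U (stage (Suc n) g U) ys" "hd ys = w'"
          unfolding merges_def rep_def head_of_bridge_def by blast
        moreover have "w' \<in> cluster (pE g) (stage (Suc n) g U) w"
          using w w' cluster_sym cluster_trans unfolding merges_def by metis
        ultimately show ?thesis using min_bridge_unique[OF U] by metis
      qed
      then have "(\<Sum>w. if gV g w \<and> merges n g U x w then 1 else (0 :: ennreal)) \<le> of_nat 1"
        by (intro suminf_le_card[of "{w}"]) auto
      then show ?thesis using w by (auto simp: merges_def)
    qed simp
    show "2 * (if rep (Suc n) g U x then 1 else (0 :: ennreal))
      \<le> (\<Sum>w. if gV g w \<and> merges n g U w x then 1 else 0)"
    proof (cases "rep (Suc n) g U x")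
      case True
      then obtain zs where zs: "min_bridge (pE g) m U (stage (Suc n) g U) zs" "hd zs = x"
        by (auto simp: rep_def head_of_bridge_def)
      then have x: "x \<in> grow (pE g) m U (stage n g U)"
        "finite (cluster (pE g) (grow (pE g) m U (stage n g U)) x)"
        by (auto simp: min_bridge_def bridge_def stage_Suc)
      obtain xs ys where *: "min_bridge (pE g) m U (stage n g U) xs"
        "min_bridge (pE g) m U (stage n g U) ys"
        "hd ys \<notin> cluster (pE g) (stage n g U) (hd xs)"
        "cluster (pE g) (stage n g U) (hd xs) \<subseteq> cluster (pE g) (grow (pE g) m U (stage n g U)) x"
        "cluster (pE g) (stage n g U) (hd ys) \<subseteq> cluster (pE g) (grow (pE g) m U (stage n g U)) x"
        by (rule grow_cluster_contains_two[OF net_stage[OF g] refl x])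
      have ne: "hd xs \<noteq> hd ys" using *(3) cluster_refl by metis
      have mg: "merges n g U (hd xs) x" "merges n g U (hd ys) x"
        using * True cluster_refl unfolding merges_def stage_Suc
        by (auto simp: rep_def head_of_bridge_def)
      then have "gV g (hd xs)" "gV g (hd ys)"
        using stage_gV[OF g rep_stage] by (auto simp: merges_def)
      then show ?thesis
        using sum_le_suminf_ennreal[of "{hd xs, hd ys}" "\<lambda>w. if gV g w \<and> merges n g U w x then 1 else 0"]
          True ne mg by simp
    qed simp
  qed auto
  finally show ?thesis by (simp add: density_def)
qed

text \<open>With weight \<open>2 * m\<close>, halving the density of representatives releases
  \<open>m * density (rep n)\<close>, exactly what the vertices added in that round may
  cost.\<close>

lemma density_stage_potential:
  "density (in_stage n) + of_nat (2 * m) * density (rep n) \<le>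
   density (in_stage 0) + of_nat (2 * m) * density (rep 0)"
proof (induction n)
  case (Suc n)
  have "density (in_stage (Suc n)) + of_nat (2 * m) * density (rep (Suc n)) \<le>
    (density (in_stage n) + of_nat m * density (rep n)) + of_nat m * density (rep n)"
  proof (rule add_mono[OF density_stage_Suc])
    have "of_nat (2 * m) * density (rep (Suc n)) = of_nat m * (2 * density (rep (Suc n)))"
      by (simp only: of_nat_mult of_nat_numeral mult_ac)
    also have "\<dots> \<le> of_nat m * density (rep n)"
      by (intro mult_left_mono density_rep_Suc) simp
    finally show "of_nat (2 * m) * density (rep (Suc n)) \<le> of_nat m * density (rep n)" .
  qed
  also have "\<dots> = density (in_stage n) + of_nat (2 * m) * density (rep n)"
    by (simp only: of_nat_mult mult_2 distrib_right add.assoc of_nat_add)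
  also note Suc.IH
  finally show ?case .
qed simp

lemma density_stage_le: "density (in_stage n) \<le> of_nat (4 * r + 5) * density (in_stage 0)"
proof -
  have "density (rep 0) \<le> density (in_stage 0)"
    unfolding density_def in_stage_def using rep_stage by (intro nn_integral_mono) auto
  then have "density (in_stage 0) + of_nat (2 * m) * density (rep 0) \<le>
    of_nat 1 * density (in_stage 0) + of_nat (2 * m) * density (in_stage 0)"
    by (intro add_mono mult_left_mono) auto
  also have "\<dots> = of_nat (4 * r + 5) * density (in_stage 0)"
  proof -
    \<comment> \<open>At stage 0 the representatives are seeds, so the potential is at most
      \<open>1 + 2 * m\<close> times the density of the seeds.\<close>
    have "4 * r + 5 = 1 + 2 * m" by simp
    then show ?thesis by (simp only: of_nat_add distrib_right)
  qed
  finally have *: "density (in_stage 0) + of_nat (2 * m) * density (rep 0) \<le>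
    of_nat (4 * r + 5) * density (in_stage 0)" .
  have "density (in_stage n) \<le> density (in_stage n) + of_nat (2 * m) * density (rep n)"
    by simp
  also note density_stage_potential
  also note *
  finally show ?thesis .
qed

text \<open>Fix the graph and average over the labels. A root in an infinite component has a low
  label with probability \<open>q\<close>; by independence its ball has none with probability
  \<open>(1 - q) ^ card ?B\<close>, which the assumed growth makes at most \<open>q\<close>. Other
  roots are never seeds.\<close>

lemma density_seeds_le:
  assumes q: "0 < q" "q \<le> 1"
    and growth: "AE z in P. \<forall>v. infinite ((pE (fst z))\<^sup>* `` {v}) \<longrightarrow>
      1 / q\<^sup>2 \<le> real (card (ball_rel (pE (fst z)) r v))"
  shows "density (in_stage 0) \<le> ennreal (2 * q)"
proof -
  have mc: "Measurable.pred PL (\<lambda>c. in_stage 0 (fst (fst c)) (snd c) (snd (fst c)))"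
    by (rule pred_at_root[OF pred_in_stage])
  have "density (in_stage 0) =
    (\<integral>\<^sup>+ z. \<integral>\<^sup>+ U. (if in_stage 0 (fst z) U (snd z) then 1 else 0) \<partial>labels \<partial>P)"
    unfolding density_def using mc by (subst M2.nn_integral_fst[symmetric]) simp_all
  also have "\<dots> \<le> (\<integral>\<^sup>+ z. ennreal (2 * q) \<partial>P)"
  proof (rule nn_integral_mono_AE)
    have "AE z in P. wf_graph (fst z)" using unimod by (auto simp: unimodular_rrg_def)
    then show "AE z in P. (\<integral>\<^sup>+ U. (if in_stage 0 (fst z) U (snd z) then 1 else 0) \<partial>labels) \<le> ennreal (2 * q)"
      using growth
    proof eventually_elim
      case (elim z)
      interpret locally_finite_graph "pE (fst z)" using elim(1) by (rule locally_finite_pE)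
      let ?v = "snd z" and ?B = "ball_rel (pE (fst z)) r (snd z)"
      let ?J = "(\<lambda>w. [w]) ` ?B"
      show ?case
      proof (cases "infinite ((pE (fst z))\<^sup>* `` {?v})")
        case True
        have fin: "finite ?J" and card: "card ?J = card ?B"
          using finite_ball_rel by (auto intro: card_image simp: inj_on_def)
        have m1: "{U. U [?v] < q} \<in> sets labels"
          using measurable_sets[OF measurable_label[of "[?v]"], of "{..<q}"] by (simp add: vimage_def)
        have m2: "{U. \<forall>xs\<in>?J. q \<le> U xs} \<in> sets labels"
        proof -
          have "{U \<in> space labels. \<forall>xs\<in>?J. q \<le> U xs} \<in> sets labels"
            using fin by measurable
          then show ?thesis by simp
        qed
        have "(\<integral>\<^sup>+ U. (if in_stage 0 (fst z) U ?v then 1 else 0) \<partial>labels) \<le>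
          (\<integral>\<^sup>+ U. indicator {U. U [?v] < q} U + indicator {U. \<forall>xs\<in>?J. q \<le> U xs} U \<partial>labels)"
          by (intro nn_integral_mono)
             (auto simp: in_stage_def stage_def closed_set_def seeds_def indicator_def)
        also have "\<dots> = emeasure labels {U. U [?v] < q} + emeasure labels {U. \<forall>xs\<in>?J. q \<le> U xs}"
          using m1 m2 by (subst nn_integral_add) auto
        also have "\<dots> = ennreal q + ennreal ((1 - q) ^ card ?B)"
          using emeasure_labels_less emeasure_labels_ge[OF _ _ fin] q card by simp
        also have "\<dots> \<le> ennreal q + ennreal q"
          using power_le_of_inverse_square[OF q] elim(2) True
          by (intro add_left_mono ennreal_leI) auto
        also have "\<dots> = ennreal (2 * q)" using q by (simp flip: ennreal_plus)
        finally show ?thesis .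
      next
        case False
        then show ?thesis by (simp add: in_stage_def stage_def closed_set_def seeds_def)
      qed
    qed
  qed
  also have "\<dots> = ennreal (2 * q)" using prob_space.emeasure_space_1[OF prob_space_P] by simp
  finally show ?thesis .
qed

end

section \<open>The percolated graph\<close>

text \<open>The second mark records openness, so \<open>Z\<close> enters through its
  complement.\<close>

definition add_closed :: "nat set \<Rightarrow> (bool, bool) mgraph \<Rightarrow> (bool \<times> bool, bool) mgraph" where
  "add_closed Z g = (gV g, gE g, \<lambda>x. (gvm g x, x \<notin> Z), gem g)"

lemma add_closed_simps [simp]:
  "gV (add_closed Z g) = gV g" "forget (add_closed Z g) = g" "om (add_closed Z g) x \<longleftrightarrow> x \<notin> Z"
  by (simp_all add: add_closed_def forget_def om_def gV_def gE_def gvm_def gem_def)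

lemma add_closed_relabel:
  assumes "bij p" "\<And>x. p x \<in> Z' \<longleftrightarrow> x \<in> Z"
  shows "add_closed Z' (relabel p g) = relabel p (add_closed Z g)"
proof -
  have "x \<in> Z' \<longleftrightarrow> inv p x \<in> Z" for x
    using assms by (metis bij_inv_eq_iff)
  then show ?thesis
    by (simp add: add_closed_def relabel_def Let_def gV_def gE_def gvm_def gem_def)
qed

lemma wf_graph_forget: "wf_graph (forget g) \<Longrightarrow> wf_graph g"
  by (simp add: wf_graph_def forget_def gV_def gE_def gem_def)

lemma measurable_forget [measurable]: "forget \<in> measurable MG MG"
  unfolding forget_def
  by (intro measurable_into_MG measurable_gV measurable_gE measurable_gem
      measurable_compose[OF measurable_gvm]) simp

lemma measurable_forget_root:
  "forget_root \<in> measurable (MG \<Otimes>\<^sub>M count_space UNIV) (MG \<Otimes>\<^sub>M count_space UNIV)"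
  unfolding forget_root_def
  by (intro measurable_Pair measurable_compose[OF measurable_fst measurable_forget] measurable_snd)

lemma measurable_om [measurable]: "Measurable.pred MG (\<lambda>g. om g x)"
  unfolding om_def by (rule measurable_compose[OF measurable_gvm]) simp

context locally_finite_graph
begin

text \<open>Property (II) asks for connectedness inside the set itself, so the path in
  \<open>S\<close> must be seen to stay in the cluster.\<close>

lemma rtrancl_within_cluster:
  assumes "x \<in> cluster E S v" "y \<in> cluster E S x"
  shows "(x, y) \<in> (E \<inter> cluster E S v \<times> cluster E S v)\<^sup>*"
  using assms(2) unfolding cluster_def[of E S x] mem_Collect_eq
proof (induction rule: rtrancl_induct)
  case (step y z)
  have "y \<in> cluster E S x" using step.hyps(1) by (simp add: cluster_def)
  then have y: "y \<in> cluster E S v" using assms(1) cluster_trans by metis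
  have "z \<in> cluster E S y" using step.hyps(2) by (auto simp: cluster_def)
  then have "z \<in> cluster E S v" using y cluster_trans by metis
  with y step.hyps(2) have "(y, z) \<in> E \<inter> cluster E S v \<times> cluster E S v" by auto
  with step.IH show ?case by (rule rtrancl_into_rtrancl)
qed simp

end

definition closed_vertices :: "(bool \<times> bool, bool) mgraph \<Rightarrow> nat set" where
  "closed_vertices g = {x \<in> pV (forget g). \<not> om g x}"

text \<open>Quantifying over lists instead of vertex sets makes property (II) visibly measurable.\<close>

definition propII_lists :: "nat \<Rightarrow> (bool \<times> bool, bool) mgraph \<Rightarrow> bool" where
  "propII_lists N g \<longleftrightarrow> (\<forall>v. v \<in> closed_vertices g \<longrightarrow>
     (\<exists>ys. distinct ys \<and> length ys = N \<and>
        (\<forall>y\<in>set ys. y \<in> cluster (pE (forget g)) (closed_vertices g) v)))"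

lemma propII_lists_imp_propII:
  assumes wf: "wf_graph (forget g)" and "propII_lists N g"
  shows "propII N g"
  unfolding propII_def
proof (intro allI impI)
  interpret locally_finite_graph "pE (forget g)" using wf by (rule locally_finite_pE)
  fix v assume "v \<in> pV (forget g) \<and> \<not> om g v"
  then have v: "v \<in> closed_vertices g" by (simp add: closed_vertices_def)
  \<comment> \<open>The set required in (II) is the whole cluster of \<open>v\<close> among the
    closed vertices, which may be infinite.\<close>
  let ?C = "cluster (pE (forget g)) (closed_vertices g) v"
  from v assms(2) obtain ys where ys: "distinct ys" "length ys = N" "set ys \<subseteq> ?C"
    unfolding propII_lists_def by blast
  have "infinite ?C \<or> N \<le> card ?C"
    using card_mono[OF _ ys(3)] distinct_card[OF ys(1)] ys(2) by auto
  moreover have "u \<in> pV (forget g) \<and> \<not> om g u" if "u \<in> ?C" for u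
    using that cluster_subset[OF v] by (auto simp: closed_vertices_def)
  moreover have "(x, y) \<in> (pE (forget g) \<inter> ?C \<times> ?C)\<^sup>*" if "x \<in> ?C" "y \<in> ?C" for x y
    using rtrancl_within_cluster[OF that(1)] that cluster_sym cluster_trans by metis
  ultimately show "\<exists>\<Psi>. v \<in> \<Psi> \<and> (infinite \<Psi> \<or> N \<le> card \<Psi>) \<and>
      (\<forall>u\<in>\<Psi>. u \<in> pV (forget g) \<and> \<not> om g u) \<and>
      (\<forall>x\<in>\<Psi>. \<forall>y\<in>\<Psi>. (x, y) \<in> (pE (forget g) \<inter> \<Psi> \<times> \<Psi>)\<^sup>*)"
    by (intro exI[of _ ?C]) auto
qed

lemma pred_forget_pE: "Measurable.pred MG (\<lambda>g. (x, y) \<in> pE (forget g))"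
  by measurable

lemma pred_closed_vertices: "Measurable.pred MG (\<lambda>g. x \<in> closed_vertices g)"
  unfolding closed_vertices_def mem_Collect_eq by measurable

text \<open>Measurability is what allows an almost sure statement about \<open>PL\<close> to pass to
  the image law through \<open>AE_distr_iff\<close>.\<close>

lemma pred_propI: "Measurable.pred MG (propI h)"
proof -
  note pred_relpow[OF pred_forget_pE, measurable] pred_finite_component[OF pred_forget_pE, measurable]
  show ?thesis unfolding propI_def pcomp_eq by measurable
qed

lemma pred_propII_lists: "Measurable.pred MG (propII_lists N)"
proof -
  note pred_cluster[OF pred_forget_pE pred_closed_vertices, measurable] pred_closed_vertices[measurable]
  show ?thesis unfolding propII_lists_def by measurable
qed

section \<open>The law of the graph with the vertices of a stage closed\<close>

context labelled_percolation
begin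

definition coloured :: "nat \<Rightarrow> (bool, bool) mgraph \<Rightarrow> (nat list \<Rightarrow> real) \<Rightarrow> (bool \<times> bool, bool) mgraph" where
  "coloured n g U = add_closed (stage n g U) g"

definition percolated :: "nat \<Rightarrow> ((bool \<times> bool, bool) mgraph \<times> nat) measure" where
  "percolated n = distr PL (MG \<Otimes>\<^sub>M count_space UNIV)
     (\<lambda>c. (coloured n (fst (fst c)) (snd c), snd (fst c)))"

lemma measurable_coloured:
  "(\<lambda>c. coloured n (fst c) (snd c)) \<in> measurable (MG \<Otimes>\<^sub>M labels) MG"
  unfolding coloured_def add_closed_def
proof (intro measurable_into_MG)
  fix x
  have "Measurable.pred (MG \<Otimes>\<^sub>M labels) (\<lambda>c. x \<notin> stage n (fst c) (snd c))" by measurable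
  then show "(\<lambda>c. (gvm (fst c) x, x \<notin> stage n (fst c) (snd c))) \<in> measurable (MG \<Otimes>\<^sub>M labels) (count_space UNIV)"
    by measurable
qed measurable

lemma measurable_coloured_root [measurable]:
  "(\<lambda>c. (coloured n (fst (fst c)) (snd c), snd (fst c))) \<in> measurable PL (MG \<Otimes>\<^sub>M count_space UNIV)"
  using measurable_compose[OF measurable_forget_root_label measurable_coloured[of n]]
  by (intro measurable_Pair) simp_all

lemma sets_percolated [simp]: "sets (percolated n) = sets (MG \<Otimes>\<^sub>M count_space UNIV)"
  by (simp add: percolated_def)

text \<open>Forgetting the second mark undoes the colouring, so what remains is the first marginal
  of \<open>PL\<close>.\<close>

lemma distr_forget_percolated:
  "distr (percolated n) (MG \<Otimes>\<^sub>M count_space UNIV) forget_root = P"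
proof -
  have "distr (percolated n) (MG \<Otimes>\<^sub>M count_space UNIV) forget_root =
    distr PL (MG \<Otimes>\<^sub>M count_space UNIV) fst"
    unfolding percolated_def
    by (subst distr_distr[OF measurable_forget_root measurable_coloured_root])
       (simp add: comp_def forget_root_def coloured_def)
  also have "\<dots> = P"
  proof (rule measure_eqI)
    fix A assume "A \<in> sets (distr PL (MG \<Otimes>\<^sub>M count_space UNIV) fst)"
    then have A: "A \<in> sets P" by (simp add: sets_P)
    have f: "fst \<in> measurable PL (MG \<Otimes>\<^sub>M count_space UNIV)" by measurable
    have "fst -` A \<inter> space PL = A \<times> space labels"
      using sets.sets_into_space[OF A] by (auto simp: space_pair_measure)
    then have "emeasure (distr PL (MG \<Otimes>\<^sub>M count_space UNIV) fst) A = emeasure PL (A \<times> space labels)"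
      using A by (simp add: emeasure_distr[OF f] sets_P)
    also have "\<dots> = emeasure P A"
      using A by (subst M2.emeasure_pair_measure_Times) (simp_all only: sets.top M2.emeasure_space_1 mult_1_right)
    finally show "emeasure (distr PL (MG \<Otimes>\<^sub>M count_space UNIV) fst) A = emeasure P A" .
  qed (simp add: sets_P)
  finally show ?thesis .
qed

lemma AE_percolated_forget:
  assumes "AE z in P. \<phi> z"
  shows "AE z in percolated n. \<phi> (forget_root z)"
proof -
  have "forget_root \<in> measurable (percolated n) (MG \<Otimes>\<^sub>M count_space UNIV)"
    using measurable_forget_root by (simp cong: measurable_cong_sets)
  moreover have "AE z in distr (percolated n) (MG \<Otimes>\<^sub>M count_space UNIV) forget_root. \<phi> z"
    using assms unfolding distr_forget_percolated .
  ultimately show ?thesis by (rule AE_distrD)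
qed

text \<open>An invariant test function of the coloured graph is a diagonally invariant function of
  graph and labels, since the stages commute with relabelling. Thus
  \<open>mass_transport_labels\<close> applies.\<close>

lemma unimodular_percolated: "unimodular (percolated n)"
  unfolding unimodular_def
proof (intro ballI impI)
  fix f :: "(bool \<times> bool, bool) mgraph \<times> nat \<times> nat \<Rightarrow> ennreal"
  assume f: "f \<in> borel_measurable (MG \<Otimes>\<^sub>M (count_space UNIV \<Otimes>\<^sub>M count_space UNIV))"
    and inv: "iso_invariant f"
  note f [measurable]
  let ?F = "\<lambda>g U x y. f (coloured n g U, x, y)"
  have 1: "(\<lambda>(g, U). ?F g U x y) \<in> borel_measurable (MG \<Otimes>\<^sub>M labels)" for x y
  proof -
    note measurable_coloured[of n, measurable]
    show ?thesis unfolding case_prod_unfold by measurable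
  qed
  have 2: "?F (relabel p g) U (p x) (p y) = ?F g (U \<circ> map p) x y" if "bij p" for p g U x y
  proof -
    have "f (relabel p h, p x, p y) = f (h, x, y)" for h
      using inv that unfolding iso_invariant_def by blast
    then show ?thesis
      using add_closed_relabel[OF that stage_iff[OF that]] by (simp only: coloured_def)
  qed
  have gV: "gV (coloured n g U) w = gV g w" for g U w
    by (simp add: coloured_def)
  have "(\<integral>\<^sup>+ z. (\<Sum>w. if gV (fst z) w then f (fst z, snd z, w) else 0) \<partial>percolated n) =
    (\<integral>\<^sup>+ c. (\<Sum>w. if gV (fst (fst c)) w then ?F (fst (fst c)) (snd c) (snd (fst c)) w else 0) \<partial>PL)"
    unfolding percolated_def by (subst nn_integral_distr) (simp_all add: gV cong: if_cong)
  also have "\<dots> =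
    (\<integral>\<^sup>+ c. (\<Sum>w. if gV (fst (fst c)) w then ?F (fst (fst c)) (snd c) w (snd (fst c)) else 0) \<partial>PL)"
    by (rule mass_transport_labels[where F = "?F", OF unimod 1 2])
  also have "\<dots> = (\<integral>\<^sup>+ z. (\<Sum>w. if gV (fst z) w then f (fst z, w, snd z) else 0) \<partial>percolated n)"
    unfolding percolated_def by (subst nn_integral_distr) (simp_all add: gV cong: if_cong)
  finally show "(\<integral>\<^sup>+ z. (\<Sum>w. if gV (fst z) w then f (fst z, snd z, w) else 0) \<partial>percolated n) =
    (\<integral>\<^sup>+ z. (\<Sum>w. if gV (fst z) w then f (fst z, w, snd z) else 0) \<partial>percolated n)" .
qed

lemma unimodular_rrg_percolated: "unimodular_rrg (percolated n)"
  unfolding unimodular_rrg_def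
proof (intro conjI)
  show "prob_space (percolated n)"
    unfolding percolated_def by (rule prob_space_distr) measurable
  have "AE z in P. wf_graph (fst z) \<and> gV (fst z) (snd z)"
    using unimod by (simp add: unimodular_rrg_def)
  from AE_percolated_forget[OF this, of n]
  show "AE z in percolated n. wf_graph (fst z) \<and> gV (fst z) (snd z)"
    by eventually_elim (auto simp: forget_root_def intro: wf_graph_forget, simp add: forget_def gV_def)
qed (auto intro: unimodular_percolated)

lemma measure_stage_root:
  assumes "density (in_stage n) \<le> ennreal \<epsilon>" "0 \<le> \<epsilon>"
  shows "measure (percolated n) {z \<in> space (percolated n). \<not> om (fst z) (snd z)} \<le> \<epsilon>"
proof -
  have m: "{z. \<not> om (fst z) (snd z)} \<in> sets (MG \<Otimes>\<^sub>M count_space UNIV)"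
  proof -
    have "Measurable.pred (MG \<Otimes>\<^sub>M count_space UNIV) (\<lambda>z. \<not> om (fst z) (snd z))"
      by (rule measurable_compose_countable[where f = "\<lambda>x z. \<not> om (fst z) x"]) measurable
    then show ?thesis by (simp add: pred_def space_pair_measure)
  qed
  have mc: "Measurable.pred PL (\<lambda>c. in_stage n (fst (fst c)) (snd c) (snd (fst c)))"
    by (rule pred_at_root[OF pred_in_stage])
  have "emeasure (percolated n) {z \<in> space (percolated n). \<not> om (fst z) (snd z)} =
    emeasure PL {c \<in> space PL. in_stage n (fst (fst c)) (snd c) (snd (fst c))}"
    unfolding percolated_def using m
    by (subst emeasure_distr[OF measurable_coloured_root])
       (auto simp: space_pair_measure in_stage_def coloured_def intro!: arg_cong[where f = "emeasure PL"])
  also have "\<dots> = (\<integral>\<^sup>+ c. indicator {c \<in> space PL. in_stage n (fst (fst c)) (snd c) (snd (fst c))} c \<partial>PL)"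
    using mc by (subst nn_integral_indicator) (auto simp: pred_def)
  also have "\<dots> = density (in_stage n)"
    unfolding density_def by (intro nn_integral_cong) (auto simp: indicator_def)
  finally show ?thesis
    using assms by (simp add: measure_def enn2real_leI)
qed

text \<open>Every stage is an \<open>r\<close>-net, which gives (I) with a radius independent of
  \<open>n\<close>; (II) comes from the doubling of finite clusters over \<open>n\<close>
  rounds.\<close>

lemma AE_propI_propII:
  assumes "N \<le> 2 ^ n"
  shows "AE z in percolated n. propI r (fst z) \<and> propII N (fst z)"
proof -
  have good: "propI r (coloured n g U) \<and> propII_lists N (coloured n g U)" if g: "wf_graph g" for g U
  proof
    interpret locally_finite_graph "pE g" using g by (rule locally_finite_pE)
    have net: "net (pE g) r (stage n g U)" by (rule net_stage[OF g])
    show "propI r (coloured n g U)"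
      unfolding propI_def
    proof (intro allI impI, elim conjE)
      fix v assume "infinite (pcomp (forget (coloured n g U)) v)"
      then have "infinite ((pE g)\<^sup>* `` {v})" by (simp add: coloured_def pcomp_eq)
      with net obtain u k where "u \<in> stage n g U" "k \<le> r" "(v, u) \<in> pE g ^^ k"
        unfolding net_def by blast
      then show "\<exists>u k. u \<in> pV (forget (coloured n g U)) \<and> \<not> om (coloured n g U) u \<and>
          k \<le> r \<and> (v, u) \<in> pE (forget (coloured n g U)) ^^ k"
        using net_subset_pV[OF net] unfolding coloured_def add_closed_simps by blast
    qed
    \<comment> \<open>The stage consists of vertices open for the first mark, so no vertex is lost
      on intersecting it with \<open>pV\<close>.\<close>
    have cv: "closed_vertices (coloured n g U) = stage n g U"
      using net_subset_pV[OF net] by (auto simp: closed_vertices_def coloured_def)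
    have "\<exists>ys. distinct ys \<and> length ys = N \<and> (\<forall>y\<in>set ys. y \<in> cluster (pE g) (stage n g U) v)"
      if v: "v \<in> stage n g U" for v
    proof -
      let ?C = "cluster (pE g) (stage n g U) v"
      have "2 ^ n \<le> card ?C" if "finite ?C"
        using v that unfolding stage_def closed_set_def
        by (rule card_cluster_grow_iterate[OF net_seeds refl])
      \<comment> \<open>An infinite cluster has subsets of every finite size; a finite one is large
        enough by doubling.\<close>
      then have "\<exists>B. finite B \<and> card B = N \<and> B \<subseteq> ?C"
        using infinite_arbitrarily_large[of ?C N] obtain_subset_with_card_n[of N ?C] assms
        by (cases "finite ?C") (force, blast)
      then obtain B where B: "finite B" "card B = N" "B \<subseteq> ?C" by blast
      from finite_distinct_list[OF B(1)] obtain ys where "set ys = B" "distinct ys" by blast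
      then show ?thesis using B distinct_card[of ys] by auto
    qed
    then show "propII_lists N (coloured n g U)"
      unfolding propII_lists_def cv by (simp add: coloured_def)
  qed
  have "AE c in PL. propI r (coloured n (fst (fst c)) (snd c)) \<and>
      propII_lists N (coloured n (fst (fst c)) (snd c))"
    using AE_good by eventually_elim (simp add: good)
  moreover have "{z \<in> space (MG \<Otimes>\<^sub>M count_space UNIV). propI r (fst z) \<and> propII_lists N (fst z)}
    \<in> sets (MG \<Otimes>\<^sub>M (count_space UNIV :: nat measure))"
  proof -
    note pred_propI[measurable] pred_propII_lists[measurable]
    show ?thesis by measurable
  qed
  ultimately have "AE z in percolated n. propI r (fst z) \<and> propII_lists N (fst z)"
    unfolding percolated_def by (subst AE_distr_iff[OF measurable_coloured_root]) simp_all
  moreover have "AE z in percolated n. wf_graph (fst (forget_root z))"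
    using unimod by (intro AE_percolated_forget) (auto simp: unimodular_rrg_def)
  ultimately show ?thesis
    by eventually_elim (simp add: propII_lists_imp_propII forget_root_def)
qed

end

section \<open>Choice of the radius, and the conclusion\<close>

lemma exists_radius:
  fixes \<alpha> \<epsilon> :: real
  assumes "\<alpha> > 0" "\<epsilon> > 0"
  obtains r :: nat and q :: real where "r > 0" "0 < q" "q \<le> 1" "1 / q\<^sup>2 = (1 + \<alpha>) ^ r"
    "real (4 * r + 5) * (2 * q) \<le> \<epsilon>"
proof -
  \<comment> \<open>The choice \<open>q = 1 / a ^ r\<close> makes \<open>1 / q\<^sup>2\<close> equal
    to the guaranteed size of an \<open>r\<close>-ball, while its exponential decay beats the linear
    factor \<open>4 * r + 5\<close>.\<close>
  define a where "a = sqrt (1 + \<alpha>)"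
  have a: "a > 1" "a\<^sup>2 = 1 + \<alpha>" using assms(1) by (simp_all add: a_def)
  have "(\<lambda>r. real (4 * r + 5) * (2 * (1 / a ^ r))) \<longlonglongrightarrow> 0"
    using a(1) by real_asymp
  then have "\<forall>\<^sub>F r in sequentially. real (4 * r + 5) * (2 * (1 / a ^ r)) < \<epsilon>"
    using assms(2) by (rule order_tendstoD)
  then have "\<forall>\<^sub>F r in sequentially. real (4 * r + 5) * (2 * (1 / a ^ r)) < \<epsilon> \<and> r > 0"
    using eventually_gt_at_top[of 0] by eventually_elim simp
  then obtain r where r: "real (4 * r + 5) * (2 * (1 / a ^ r)) < \<epsilon>" "r > 0"
    by (auto dest: eventually_happens)
  have "1 / (1 / a ^ r)\<^sup>2 = (1 + \<alpha>) ^ r"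
    using a by (simp add: power_divide power_mult[symmetric] mult.commute flip: a(2))
  then show ?thesis using that[of r "1 / a ^ r"] r a by simp
qed

theorem theorem5p1:
  fixes \<alpha> \<epsilon> :: real and D :: nat
  assumes "\<alpha> > 0" and "D \<ge> 2" and "0 < \<epsilon>" and "\<epsilon> < 1/2"
  shows "\<exists>h::nat. h > 0 \<and>
    (\<forall>P :: ((bool,bool) mgraph \<times> nat) measure.
       unimodular_rrg P \<and>
       (AE z in P. is_percolation (fst z) \<and> degree_ok D (fst z) \<and> expansion_ok \<alpha> (fst z))
       \<longrightarrow>
       (\<forall>N::nat. N > 0 \<longrightarrow>
          (\<exists>Q :: ((bool \<times> bool, bool) mgraph \<times> nat) measure.
             unimodular_rrg Q \<and>
             distr Q (MG \<Otimes>\<^sub>M count_space UNIV) forget_root = P \<and>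
             measure Q {z \<in> space Q. \<not> om (fst z) (snd z)} \<le> \<epsilon> \<and>
             (AE z in Q. propI h (fst z) \<and> propII N (fst z)))))"
proof -
  \<comment> \<open>Both parameters are fixed before \<open>P\<close> and \<open>N\<close>, so
    \<open>h = r\<close> serves for all of them.\<close>
  obtain r q where r: "r > 0" and q: "0 < q" "q \<le> 1" "1 / q\<^sup>2 = (1 + \<alpha>) ^ r"
    "real (4 * r + 5) * (2 * q) \<le> \<epsilon>"
    using exists_radius[OF assms(1,3)] by metis
  have "\<exists>Q :: ((bool \<times> bool, bool) mgraph \<times> nat) measure.
      unimodular_rrg Q \<and> distr Q (MG \<Otimes>\<^sub>M count_space UNIV) forget_root = P \<and>
      measure Q {z \<in> space Q. \<not> om (fst z) (snd z)} \<le> \<epsilon> \<and>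
      (AE z in Q. propI r (fst z) \<and> propII N (fst z))"
    if P: "unimodular_rrg P" and exp: "AE z in P. expansion_ok \<alpha> (fst z)"
    for P :: "((bool,bool) mgraph \<times> nat) measure" and N :: nat
  proof -
    interpret labelled_percolation P r q using P by unfold_locales
    have "AE z in P. wf_graph (fst z)" using P by (auto simp: unimodular_rrg_def)
    then have "AE z in P. \<forall>v. infinite ((pE (fst z))\<^sup>* `` {v}) \<longrightarrow>
      1 / q\<^sup>2 \<le> real (card (ball_rel (pE (fst z)) r v))"
      using exp
    proof eventually_elim
      case (elim z)
      interpret locally_finite_graph "pE (fst z)" using elim(1) by (rule locally_finite_pE)
      show ?case
      proof (intro allI impI)
        fix v assume inf: "infinite ((pE (fst z))\<^sup>* `` {v})"
        have "v \<in> pV (fst z)"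
        proof -
          \<comment> \<open>The set of all vertices with infinite component is a net of radius 0, so
            \<open>net_subset_pV\<close> shows that these vertices are open.\<close>
          have "net (pE (fst z)) 0 {v. infinite ((pE (fst z))\<^sup>* `` {v})}"
            by (auto simp: net_def)
          from net_subset_pV[OF this] inf show ?thesis by blast
        qed
        then show "1 / q\<^sup>2 \<le> real (card (ball_rel (pE (fst z)) r v))"
          unfolding q(3) using elim(2) inf assms(1)
          by (intro card_ball_rel_ge) (auto simp: expansion_ok_def pcomp_eq inner_boundary_def)
      qed
    qed
    from density_seeds_le[OF q(1,2) this]
    have "of_nat (4 * r + 5) * density (in_stage 0) \<le> of_nat (4 * r + 5) * ennreal (2 * q)"
      by (rule mult_left_mono) simp
    also have "\<dots> = ennreal (real (4 * r + 5) * (2 * q))"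
      using q(1) by (simp only: ennreal_of_nat_eq_real_of_nat ennreal_mult'')
    also have "\<dots> \<le> ennreal \<epsilon>" using q(4) by (rule ennreal_leI)
    finally have "density (in_stage N) \<le> ennreal \<epsilon>" using density_stage_le order_trans by blast
    then have "measure (percolated N) {z \<in> space (percolated N). \<not> om (fst z) (snd z)} \<le> \<epsilon>"
      using assms(3) by (intro measure_stage_root) auto
    \<comment> \<open>Running \<open>N\<close> rounds is more than enough, and costs nothing since
      the density bound is uniform in the number of rounds.\<close>
    moreover have "N \<le> 2 ^ N" by (simp add: less_imp_le)
    ultimately show ?thesis
      using unimodular_rrg_percolated distr_forget_percolated AE_propI_propII by blast
  qed
  then show ?thesis using r by (intro exI[of _ r]) auto
qed

end
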